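(* The following hold for any domain $\Omega$ in $\mathbb{R}^n$, $n\ge 3$: (i) If $\Omega$ is complete hyperbolic, then it is taut. (ii) If $\Omega$ is taut, then it is hyperbolic.
   Context: A domain is a nonempty connected open set. $\mathbb{D}=\{z=x+iy\in\mathbb{C}:|z|<1\}$. A $C^1$ map $f$ from an open subset of $\mathbb{R}^2=\mathbb{C}$ to $\mathbb{R}^n$ is conformal if $|f_x|=|f_y|$ and $f_x\cdot f_y=0$ at every point (it need not be an immersion). $\mathrm{CH}(\mathbb{D},\Omega)$ denotes the set of all conformal harmonic maps $\mathbb{D}\to\Omega$. Minimal pseudometric: for $\mathbf{x}\in\Omega$, $\mathbf{v}\in\mathbb{R}^n$, $$g_\Omega(\mathbf{x},\mathbf{v})=\inf\{1/r>0:\exists f\in \mathrm{CH}(\mathbb{D},\Omega),\ f(0)=\mathbf{x},\ f_x(0)=r\mathbf{v}\}.$$ Minimal pseudodistance: $\rho_\Omega(\mathbf{x},\mathbf{y})=\inf_\gamma\int_0^1 g_\Omega(\gamma(t),\dot\gamma(t))\,dt$, the infimum over all piecewise smooth paths $\gamma:[0,1]\to\Omega$ from $\mathbf{x}$ to $\mathbf{y}$. $\Omega$ is hyperbolic if $\rho_\Omega(\mathbf{x},\mathbf{y})>0$ for any pair of distinct points of $\Omega$ (so $\rho_\Omega$ is a metric), and complete hyperbolic if moreover $(\Omega,\rho_\Omega)$ is a complete metric space. A sequence $(f_i)$ of continuous maps $\mathbb{D}\to\Omega$ is compactly divergent if for any pair of compact sets $K\subset\mathbb{D}$ and $K'\subset\Omega$,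 $f_i(K)\cap K'$ is empty for all but finitely many $i$. A family of continuous maps $\mathbb{D}\to\Omega$ is normal if each sequence in the family has a subsequence which either converges uniformly on compact sets in $\mathbb D$ to a map $\mathbb D\to\Omega$, or is compactly divergent. $\Omega$ is taut if $\mathrm{CH}(\mathbb{D},\Omega)$ is a normal family. *)

theory Defs
  imports "HOL-Analysis.Analysis"
begin

text \<open>A domain is required to be nonempty.\<close>

definition is_domain :: "'a::topological_space set \<Rightarrow> bool" where
  "is_domain \<Omega> \<longleftrightarrow> \<Omega> \<noteq> {} \<and> connected \<Omega> \<and> open \<Omega>"

abbreviation unit_disc :: "complex set" where
  "unit_disc \<equiv> ball 0 1"

text \<open>The partial derivatives with respect to the real coordinates of \<open>z = x + iy\<close>.
  They are meaningful only at points of (real) differentiability.\<close>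

definition dx :: "(complex \<Rightarrow> 'a::real_normed_vector) \<Rightarrow> complex \<Rightarrow> 'a" where
  "dx f z = frechet_derivative f (at z) 1"

definition dy :: "(complex \<Rightarrow> 'a::real_normed_vector) \<Rightarrow> complex \<Rightarrow> 'a" where
  "dy f z = frechet_derivative f (at z) \<i>"

text \<open>In the next four definitions \<open>U\<close> is understood to be open.\<close>

definition C1_map_on :: "complex set \<Rightarrow> (complex \<Rightarrow> 'a::real_normed_vector) \<Rightarrow> bool" where
  "C1_map_on U f \<longleftrightarrow>
     (\<forall>z\<in>U. f differentiable (at z)) \<and> continuous_on U (dx f) \<and> continuous_on U (dy f)"

definition conformal_map_on :: "complex set \<Rightarrow> (complex \<Rightarrow> 'a::real_inner) \<Rightarrow> bool" where
  "conformal_map_on U f \<longleftrightarrow>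
     C1_map_on U f \<and> (\<forall>z\<in>U. norm (dx f z) = norm (dy f z) \<and> dx f z \<bullet> dy f z = 0)"

definition harmonic_map_on :: "complex set \<Rightarrow> (complex \<Rightarrow> 'a::real_normed_vector) \<Rightarrow> bool" where
  "harmonic_map_on U f \<longleftrightarrow>
     C1_map_on U f \<and> C1_map_on U (dx f) \<and> C1_map_on U (dy f) \<and>
     (\<forall>z\<in>U. dx (dx f) z + dy (dy f) z = 0)"

definition CH :: "complex set \<Rightarrow> 'a::real_inner set \<Rightarrow> (complex \<Rightarrow> 'a) set" where
  "CH U \<Omega> = {f. conformal_map_on U f \<and> harmonic_map_on U f \<and> f ` U \<subseteq> \<Omega>}"

text \<open>If \<open>x\<close> lies in the open set \<open>\<Omega>\<close> and the dimension is at least 2, the set below is nonempty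
  (it is witnessed by affine conformal discs), so the real-valued infimum is the intended one.\<close>

definition minimal_pseudometric :: "'a::real_inner set \<Rightarrow> 'a \<Rightarrow> 'a \<Rightarrow> real" where
  "minimal_pseudometric \<Omega> x v =
     Inf {1 / r | r. r > 0 \<and> (\<exists>f\<in>CH unit_disc \<Omega>. f 0 = x \<and> dx f 0 = r *\<^sub>R v)}"

text \<open>Smoothness means \<open>C\<^sup>\<infinity>\<close>, with one-sided derivatives of all orders at the endpoints;
  \<open>D k\<close> is the \<open>k\<close>-th derivative.\<close>

definition smooth_on_interval :: "real \<Rightarrow> real \<Rightarrow> (real \<Rightarrow> 'a::real_normed_vector) \<Rightarrow> bool" where
  "smooth_on_interval a b \<gamma> \<longleftrightarrow>
     (\<exists>D :: nat \<Rightarrow> real \<Rightarrow> 'a. D 0 = \<gamma> \<and>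
        (\<forall>k. \<forall>t\<in>{a..b}. (D k has_vector_derivative D (Suc k) t) (at t within {a..b})))"

text \<open>This is stronger than \<^const>\<open>valid_path\<close>, which permits the derivative to be unbounded
  near the break points.\<close>

definition piecewise_smooth_path :: "(real \<Rightarrow> 'a::real_normed_vector) \<Rightarrow> bool" where
  "piecewise_smooth_path \<gamma> \<longleftrightarrow> path \<gamma> \<and>
     (\<exists>(m::nat) p. p 0 = 0 \<and> p m = 1 \<and>
        (\<forall>i<m. p i < p (Suc i) \<and> smooth_on_interval (p i) (p (Suc i)) \<gamma>))"

text \<open>The derivative of the path may fail to exist at the finitely many break points, which do not
  contribute to the integral.\<close>

definition minimal_length :: "'a::real_inner set \<Rightarrow> (real \<Rightarrow> 'a) \<Rightarrow> ennreal" where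
  "minimal_length \<Omega> \<gamma> =
     (\<integral>\<^sup>+ t\<in>{0..1}. ennreal (minimal_pseudometric \<Omega> (\<gamma> t)
                              (vector_derivative \<gamma> (at t within {0..1}))) \<partial>lborel)"

definition minimal_pseudodist :: "'a::real_inner set \<Rightarrow> 'a \<Rightarrow> 'a \<Rightarrow> ennreal" where
  "minimal_pseudodist \<Omega> x y =
     (INF \<gamma>\<in>{\<gamma>. piecewise_smooth_path \<gamma> \<and> path_image \<gamma> \<subseteq> \<Omega> \<and>
                pathstart \<gamma> = x \<and> pathfinish \<gamma> = y}. minimal_length \<Omega> \<gamma>)"

definition hyperbolic :: "'a::real_inner set \<Rightarrow> bool" where
  "hyperbolic \<Omega> \<longleftrightarrow> (\<forall>x\<in>\<Omega>. \<forall>y\<in>\<Omega>. x \<noteq> y \<longrightarrow> minimal_pseudodist \<Omega> x y > 0)"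

text \<open>On a domain of dimension at least 2 the pseudodistance is finite, so passing to
  real values by \<^const>\<open>enn2real\<close> loses nothing.\<close>

definition complete_hyperbolic :: "'a::real_inner set \<Rightarrow> bool" where
  "complete_hyperbolic \<Omega> \<longleftrightarrow> hyperbolic \<Omega> \<and>
     Metric_space \<Omega> (\<lambda>x y. enn2real (minimal_pseudodist \<Omega> x y)) \<and>
     Metric_space.mcomplete \<Omega> (\<lambda>x y. enn2real (minimal_pseudodist \<Omega> x y))"

definition compactly_divergent ::
  "'a::topological_space set \<Rightarrow> 'b::topological_space set \<Rightarrow> (nat \<Rightarrow> 'a \<Rightarrow> 'b) \<Rightarrow> bool" where
  "compactly_divergent U \<Omega> f \<longleftrightarrow>
     (\<forall>K K'. compact K \<and> K \<subseteq> U \<and> compact K' \<and> K' \<subseteq> \<Omega> \<longrightarrow>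
        finite {i. f i ` K \<inter> K' \<noteq> {}})"

text \<open>The members of \<open>F\<close> are understood to be continuous maps \<open>U \<rightarrow> \<Omega>\<close>. Note that the
  limit map \<open>g\<close> must take its values in \<open>\<Omega>\<close>, not merely in its closure.\<close>

definition normal_family ::
  "'a::topological_space set \<Rightarrow> 'b::metric_space set \<Rightarrow> ('a \<Rightarrow> 'b) set \<Rightarrow> bool" where
  "normal_family U \<Omega> F \<longleftrightarrow>
     (\<forall>f :: nat \<Rightarrow> 'a \<Rightarrow> 'b. range f \<subseteq> F \<longrightarrow>
        (\<exists>r :: nat \<Rightarrow> nat. strict_mono r \<and>
           ((\<exists>g. g ` U \<subseteq> \<Omega> \<and>
                 (\<forall>K. compact K \<and> K \<subseteq> U \<longrightarrow> uniform_limit K (f \<circ> r) g sequentially)) \<or>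
            compactly_divergent U \<Omega> (f \<circ> r))))"

definition taut :: "'a::real_inner set \<Rightarrow> bool" where
  "taut \<Omega> \<longleftrightarrow> normal_family unit_disc \<Omega> (CH unit_disc \<Omega>)"

end

theory Submission
  imports Defs "HOL-Complex_Analysis.Complex_Analysis"
begin

text \<open>Both implications rest on the fact that each component of a harmonic map of the disc is the
  real part of a holomorphic function, which bounds derivatives by bounds on the values.

  If \<open>\<Omega>\<close> is taut, then conformal harmonic discs centred in a compact set have bounded derivative at the
  centre, since discs with derivatives tending to infinity could neither subconverge nor diverge.
  Hence \<open>g\<^sub>\<Omega>\<close> locally dominates a multiple of the Euclidean norm, and any path leaving a small ball
  around its starting point has length bounded below.

  If \<open>\<Omega>\<close> is complete hyperbolic, then \<open>\<rho>\<^sub>\<Omega>\<close> induces the Euclidean topology and, being a length metric,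
  has compact closed balls (Hopf--Rinow). Restricting a disc \<open>f\<close> to smaller discs around \<open>z\<close> gives
  \<open>g\<^sub>\<Omega>(f(z), df\<^sub>z(c)) \<le> |c| / (1 - |z|)\<close>. So if the discs of a sequence meet a fixed compact set over a
  fixed compact subset of the unit disc, they map each smaller disc into one compact \<open>\<rho>\<^sub>\<Omega>\<close>-ball, and
  Arzela--Ascoli applies.\<close>

section \<open>Harmonic and conformal maps\<close>

text \<open>The integrand of \<open>minimal_length\<close> is treated as possibly nonmeasurable, so
  its integral is only superadditive over adjacent intervals. That direction gives what is used of a
  length metric: on a path from \<open>x\<close> to \<open>y\<close> of length below
  \<open>c\<close>, every point satisfies
  \<open>\<rho> x (\<gamma> t) + \<rho> (\<gamma> t) y < c\<close>. The opposite direction would be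
  the triangle inequality, which is part of the assumption \<open>complete_hyperbolic\<close>.
  \<open>piecewise_smooth_path\<close> demands derivatives of all orders, whereas the maps in
  \<open>CH\<close> are only asked to be twice continuously differentiable. The image of a segment
  under such a map becomes an admissible path through the holomorphic representation, which supplies
  the higher derivatives. Compactness of the closed balls acts twice in the first implication: it
  bounds the maps uniformly on smaller discs, and, since compact sets are closed in the ambient
  space, it keeps the limit map inside \<Omega>.\<close>

text \<open>\<open>dx\<close> and \<open>dy\<close> rest on \<open>frechet_derivative\<close>, a
  choice operator that cannot be computed with directly. With explicit candidates \<open>a\<close>
  and \<open>b\<close> the rules for \<open>has_derivative\<close> apply, and
  \<open>partials_on_eq\<close> translates back.\<close>

definition partials_on ::
  "complex set \<Rightarrow> (complex \<Rightarrow> 'a::real_normed_vector) \<Rightarrow> (complex \<Rightarrow> 'a) \<Rightarrow> (complex \<Rightarrow> 'a) \<Rightarrow> bool" where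
  "partials_on U f a b \<longleftrightarrow>
     (\<forall>z\<in>U. (f has_derivative (\<lambda>h. Re h *\<^sub>R a z + Im h *\<^sub>R b z)) (at z)) \<and>
     continuous_on U a \<and> continuous_on U b"

lemma has_derivative_partials:
  assumes "f differentiable (at z)"
  shows "(f has_derivative (\<lambda>h. Re h *\<^sub>R dx f z + Im h *\<^sub>R dy f z)) (at z)"
proof -
  have D: "(f has_derivative frechet_derivative f (at z)) (at z)"
    using assms frechet_derivative_works by blast
  then have lin: "linear (frechet_derivative f (at z))"
    by (rule has_derivative_linear)
  have "frechet_derivative f (at z) h = Re h *\<^sub>R dx f z + Im h *\<^sub>R dy f z" for h
  proof -
    have "h = Re h *\<^sub>R 1 + Im h *\<^sub>R \<i>"
      by (simp add: complex_eq_iff)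
    then show ?thesis
      using linear_add[OF lin, of "Re h *\<^sub>R 1" "Im h *\<^sub>R \<i>"] linear_scale[OF lin]
      unfolding dx_def dy_def by metis
  qed
  then have "frechet_derivative f (at z) = (\<lambda>h. Re h *\<^sub>R dx f z + Im h *\<^sub>R dy f z)"
    by (rule ext)
  with D show ?thesis by metis
qed

lemma partials_eqI:
  assumes "(f has_derivative (\<lambda>h. Re h *\<^sub>R a + Im h *\<^sub>R b)) (at z)"
  shows "dx f z = a" "dy f z = b"
  by (simp_all add: dx_def dy_def frechet_derivative_at[OF assms, symmetric])

lemma partials_on_eq:
  assumes "partials_on U f a b" "z \<in> U"
  shows "dx f z = a z" "dy f z = b z"
  using assms partials_eqI unfolding partials_on_def by blast+

lemma C1_map_on_iff_partials: "C1_map_on U f \<longleftrightarrow> partials_on U f (dx f) (dy f)"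
  unfolding C1_map_on_def partials_on_def
  using has_derivative_partials differentiableI by blast

lemma partials_on_cong:
  assumes "partials_on U f a b" "open U"
    and "\<And>z. z \<in> U \<Longrightarrow> f' z = f z" "\<And>z. z \<in> U \<Longrightarrow> a' z = a z" "\<And>z. z \<in> U \<Longrightarrow> b' z = b z"
  shows "partials_on U f' a' b'"
proof -
  have "(f' has_derivative (\<lambda>h. Re h *\<^sub>R a' z + Im h *\<^sub>R b' z)) (at z)" if "z \<in> U" for z
  proof (rule has_derivative_transform_within_open)
    show "(f has_derivative (\<lambda>h. Re h *\<^sub>R a' z + Im h *\<^sub>R b' z)) (at z)"
      using assms that by (simp add: partials_on_def)
  qed (use assms that in auto)
  moreover have "continuous_on U a'" "continuous_on U b'"
    using assms by (simp_all add: partials_on_def cong: continuous_on_cong)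
  ultimately show ?thesis
    by (simp add: partials_on_def)
qed

lemma partials_on_imp_C1:
  assumes "partials_on U f a b" "open U"
  shows "C1_map_on U f"
  unfolding C1_map_on_iff_partials
  by (rule partials_on_cong[OF assms]) (auto simp: partials_on_eq[OF assms(1)])

lemma partials_on_imp_continuous: "partials_on U f a b \<Longrightarrow> continuous_on U f"
  unfolding partials_on_def
  by (meson continuous_at_imp_continuous_on has_derivative_continuous)

text \<open>Naming all first and second partial derivatives reduces harmonicity to one identity
  between explicit formulas and avoids nested uses of \<open>frechet_derivative\<close>.\<close>

lemma harmonic_map_onI:
  assumes "open U" "partials_on U f a b" "partials_on U a p q" "partials_on U b r s"
    and "\<And>z. z \<in> U \<Longrightarrow> p z + s z = 0"
  shows "harmonic_map_on U f"
proof -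
  have x: "partials_on U (dx f) p q" and y: "partials_on U (dy f) r s"
    by (rule partials_on_cong[OF assms(3,1)], simp_all add: partials_on_eq[OF assms(2)])
       (rule partials_on_cong[OF assms(4,1)], simp_all add: partials_on_eq[OF assms(2)])
  show ?thesis
    unfolding harmonic_map_on_def
    using assms(5) partials_on_imp_C1[OF assms(2,1)] partials_on_imp_C1[OF x assms(1)]
      partials_on_imp_C1[OF y assms(1)] partials_on_eq[OF x] partials_on_eq[OF y] by simp
qed

lemma harmonic_map_onD:
  assumes "harmonic_map_on U f"
  shows "partials_on U f (dx f) (dy f)"
    "partials_on U (dx f) (dx (dx f)) (dy (dx f))"
    "partials_on U (dy f) (dx (dy f)) (dy (dy f))"
    "\<And>z. z \<in> U \<Longrightarrow> dx (dx f) z + dy (dy f) z = 0"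
  using assms by (auto simp: harmonic_map_on_def C1_map_on_iff_partials)

section \<open>Linear images and complex affine substitutions\<close>

lemma partials_on_linear:
  assumes L: "bounded_linear L" and f: "partials_on U f a b"
  shows "partials_on U (\<lambda>z. L (f z)) (\<lambda>z. L (a z)) (\<lambda>z. L (b z))"
proof -
  interpret L: bounded_linear L by fact
  have "((\<lambda>z. L (f z)) has_derivative (\<lambda>h. Re h *\<^sub>R L (a z) + Im h *\<^sub>R L (b z))) (at z)" if "z \<in> U" for z
    using L.has_derivative[of f "\<lambda>h. Re h *\<^sub>R a z + Im h *\<^sub>R b z" "at z"] f that
    by (simp add: partials_on_def L.add L.scaleR)
  moreover have "continuous_on U (\<lambda>z. L (a z))" "continuous_on U (\<lambda>z. L (b z))"
    using f by (auto simp: partials_on_def intro: L.continuous_on)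
  ultimately show ?thesis
    by (simp add: partials_on_def)
qed

lemma partials_on_linear_combination:
  assumes "partials_on U f a b" "partials_on U g a' b'"
  shows "partials_on U (\<lambda>z. s *\<^sub>R f z + t *\<^sub>R g z) (\<lambda>z. s *\<^sub>R a z + t *\<^sub>R a' z) (\<lambda>z. s *\<^sub>R b z + t *\<^sub>R b' z)"
  using assms unfolding partials_on_def
  by (auto intro!: continuous_intros derivative_eq_intros simp: algebra_simps)

text \<open>The chain rule: the coefficients are the real and imaginary parts of
  \<open>c * 1\<close> and \<open>c * \<i>\<close>.\<close>

lemma partials_on_affine:
  assumes f: "partials_on U f a b" and V: "\<And>z. z \<in> V \<Longrightarrow> w + c * z \<in> U"
  shows "partials_on V (\<lambda>z. f (w + c * z))
           (\<lambda>z. Re c *\<^sub>R a (w + c * z) + Im c *\<^sub>R b (w + c * z))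
           (\<lambda>z. (- Im c) *\<^sub>R a (w + c * z) + Re c *\<^sub>R b (w + c * z))"
proof -
  have "((\<lambda>z. f (w + c * z)) has_derivative
          (\<lambda>h. Re h *\<^sub>R (Re c *\<^sub>R a (w + c * z) + Im c *\<^sub>R b (w + c * z)) +
               Im h *\<^sub>R ((- Im c) *\<^sub>R a (w + c * z) + Re c *\<^sub>R b (w + c * z)))) (at z)" if "z \<in> V" for z
  proof -
    have "((\<lambda>z. w + c * z) has_derivative (\<lambda>h. c * h)) (at z)"
      by (auto intro!: derivative_eq_intros)
    moreover have "(f has_derivative (\<lambda>h. Re h *\<^sub>R a (w + c * z) + Im h *\<^sub>R b (w + c * z))) (at (w + c * z))"
      using f V that by (auto simp: partials_on_def)
    ultimately have "((\<lambda>z. f (w + c * z)) has_derivative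
        (\<lambda>h. Re (c * h) *\<^sub>R a (w + c * z) + Im (c * h) *\<^sub>R b (w + c * z))) (at z)"
      by (rule has_derivative_compose)
    then show ?thesis
      by (rule has_derivative_eq_rhs) (auto simp: algebra_simps)
  qed
  moreover have "continuous_on V (\<lambda>z. a (w + c * z))" "continuous_on V (\<lambda>z. b (w + c * z))"
    using f V unfolding partials_on_def
    by (auto intro!: continuous_on_compose2[of U _ V "\<lambda>z. w + c * z"] continuous_intros)
  ultimately show ?thesis
    unfolding partials_on_def by (auto intro!: continuous_intros)
qed

lemma harmonic_map_on_linear:
  assumes L: "bounded_linear L" and U: "open U" and f: "harmonic_map_on U f"
  shows "harmonic_map_on U (\<lambda>z. L (f z))"
    "\<And>z. z \<in> U \<Longrightarrow> dx (\<lambda>z. L (f z)) z = L (dx f z)"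
    "\<And>z. z \<in> U \<Longrightarrow> dy (\<lambda>z. L (f z)) z = L (dy f z)"
proof -
  note P = partials_on_linear[OF L] and H = harmonic_map_onD[OF f]
  show "harmonic_map_on U (\<lambda>z. L (f z))"
    by (rule harmonic_map_onI[OF U P[OF H(1)] P[OF H(2)] P[OF H(3)]])
       (simp add: H(4) bounded_linear.linear[OF L] linear_0 flip: linear_add[OF bounded_linear.linear[OF L]])
  show "\<And>z. z \<in> U \<Longrightarrow> dx (\<lambda>z. L (f z)) z = L (dx f z)"
    "\<And>z. z \<in> U \<Longrightarrow> dy (\<lambda>z. L (f z)) z = L (dy f z)"
    using partials_on_eq[OF P[OF H(1)]] by blast+
qed

text \<open>The new Laplacian is \<open>(norm c)\<^sup>2\<close> times the old one. The mixed terms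
  cancel in pairs, without any appeal to the symmetry of second derivatives.\<close>

lemma harmonic_map_on_affine:
  assumes V: "open V" "\<And>z. z \<in> V \<Longrightarrow> w + c * z \<in> U" and f: "harmonic_map_on U f"
  shows "harmonic_map_on V (\<lambda>z. f (w + c * z))"
proof -
  note P = partials_on_affine[OF _ V(2)] and H = harmonic_map_onD[OF f]
  show ?thesis
  proof (rule harmonic_map_onI[OF V(1) P[OF H(1)]
        partials_on_linear_combination[OF P[OF H(2)] P[OF H(3)]]
        partials_on_linear_combination[OF P[OF H(2)] P[OF H(3)]]])
    fix z assume z: "z \<in> V"
    define p q r s where "p = dx (dx f) (w + c * z)" "q = dy (dx f) (w + c * z)"
      "r = dx (dy f) (w + c * z)" "s = dy (dy f) (w + c * z)"
    have "s = - p"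
      using H(4)[OF V(2)[OF z]] by (simp add: p_q_r_s_def add_eq_0_iff)
    then show "Re c *\<^sub>R (Re c *\<^sub>R dx (dx f) (w + c * z) + Im c *\<^sub>R dy (dx f) (w + c * z)) +
      Im c *\<^sub>R (Re c *\<^sub>R dx (dy f) (w + c * z) + Im c *\<^sub>R dy (dy f) (w + c * z)) +
      ((- Im c) *\<^sub>R ((- Im c) *\<^sub>R dx (dx f) (w + c * z) + Re c *\<^sub>R dy (dx f) (w + c * z)) +
       Re c *\<^sub>R ((- Im c) *\<^sub>R dx (dy f) (w + c * z) + Re c *\<^sub>R dy (dy f) (w + c * z))) = 0"
      unfolding p_q_r_s_def[symmetric] by (simp add: algebra_simps)
  qed
qed

text \<open>Multiplication by \<open>c\<close> is a rotation followed by scaling, so it turns a pair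
  of orthogonal vectors of equal norm into another such pair.\<close>

lemma conformal_map_on_affine:
  assumes V: "open V" "\<And>z. z \<in> V \<Longrightarrow> w + c * z \<in> U" and f: "conformal_map_on U f"
  shows "conformal_map_on V (\<lambda>z. f (w + c * z))"
proof -
  have C: "partials_on U f (dx f) (dy f)"
    using f by (simp add: conformal_map_on_def C1_map_on_iff_partials)
  note P = partials_on_affine[OF C V(2)]
  have "norm (dx (\<lambda>z. f (w + c * z)) z) = norm (dy (\<lambda>z. f (w + c * z)) z) \<and>
        dx (\<lambda>z. f (w + c * z)) z \<bullet> dy (\<lambda>z. f (w + c * z)) z = 0" if z: "z \<in> V" for z
  proof -
    define a b where "a = dx f (w + c * z)" "b = dy f (w + c * z)"
    have ab: "a \<bullet> a = b \<bullet> b" "a \<bullet> b = 0" "b \<bullet> a = 0"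
      using f V(2)[OF z] by (auto simp: conformal_map_on_def a_b_def norm_eq inner_commute)
    have e: "dx (\<lambda>z. f (w + c * z)) z = Re c *\<^sub>R a + Im c *\<^sub>R b"
      "dy (\<lambda>z. f (w + c * z)) z = (- Im c) *\<^sub>R a + Re c *\<^sub>R b"
      using partials_on_eq[OF P z] by (simp_all add: a_b_def)
    show ?thesis
      unfolding e norm_eq by (simp add: inner_add_left inner_add_right ab algebra_simps)
  qed
  then show ?thesis
    using partials_on_imp_C1[OF P V(1)] by (simp add: conformal_map_on_def)
qed

lemma CH_affine:
  assumes "open V" "\<And>z. z \<in> V \<Longrightarrow> w + c * z \<in> U" "f \<in> CH U \<Omega>"
  shows "(\<lambda>z. f (w + c * z)) \<in> CH V \<Omega>"
  using assms harmonic_map_on_affine[OF assms(1,2)] conformal_map_on_affine[OF assms(1,2)]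
  unfolding CH_def by blast

lemma CH_D:
  assumes "f \<in> CH U \<Omega>"
  shows "harmonic_map_on U f" "conformal_map_on U f" "z \<in> U \<Longrightarrow> f z \<in> \<Omega>"
    "continuous_on U f" "partials_on U f (dx f) (dy f)"
  using assms harmonic_map_onD(1)[of U f] partials_on_imp_continuous[of U f "dx f" "dy f"]
  by (auto simp: CH_def)

lemma affine_map_in_CH:
  assumes "open U" "norm v = norm w" "v \<bullet> w = 0"
    and "\<And>z. z \<in> U \<Longrightarrow> x + Re z *\<^sub>R v + Im z *\<^sub>R w \<in> \<Omega>"
  shows "(\<lambda>z. x + Re z *\<^sub>R v + Im z *\<^sub>R w) \<in> CH U \<Omega>" "dx (\<lambda>z. x + Re z *\<^sub>R v + Im z *\<^sub>R w) z = v"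
proof -
  let ?f = "\<lambda>z. x + Re z *\<^sub>R v + Im z *\<^sub>R w"
  have f: "partials_on V ?f (\<lambda>z. v) (\<lambda>z. w)" for V
    unfolding partials_on_def by (auto intro!: derivative_eq_intros)
  have c: "partials_on U (\<lambda>z. u) (\<lambda>z. 0) (\<lambda>z. 0)" for u :: 'a
    unfolding partials_on_def by auto
  show "dx ?f z = v"
    using partials_on_eq[OF f[of UNIV]] by simp
  have "harmonic_map_on U ?f"
    by (rule harmonic_map_onI[OF assms(1) f c c]) simp
  then show "?f \<in> CH U \<Omega>"
    using assms partials_on_eq[OF f[of U]] partials_on_imp_C1[OF f assms(1)]
    unfolding CH_def conformal_map_on_def by auto
qed

section \<open>Holomorphic representation of harmonic functions and gradient estimates\<close>

text \<open>The second difference \<open>D\<close> of \<open>u\<close> over a small square with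
  corner \<open>z\<close> is evaluated by two mean value theorems, once in each order of the
  variables. This gives equal values of \<open>q\<close> and \<open>r\<close> at two points of the
  square, and continuity at \<open>z\<close> concludes.\<close>

lemma mixed_partials_eq:
  fixes u :: "complex \<Rightarrow> real"
  assumes U: "open U" and u: "partials_on U u a b" and a: "partials_on U a p q"
    and b: "partials_on U b r s" and z: "z \<in> U"
  shows "q z = r z"
proof (rule ccontr)
  assume ne: "q z \<noteq> r z"
  define e where "e = \<bar>q z - r z\<bar> / 2"
  have e: "e > 0" using ne by (simp add: e_def)
  have cont: "isCont q z" "isCont r z"
    using a b z U by (auto simp: partials_on_def continuous_on_eq_continuous_at)
  obtain d1 where d1: "d1 > 0" "\<And>w. dist w z < d1 \<Longrightarrow> dist (q w) (q z) < e"
    using cont(1) e unfolding continuous_at_eps_delta by blast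
  obtain d2 where d2: "d2 > 0" "\<And>w. dist w z < d2 \<Longrightarrow> dist (r w) (r z) < e"
    using cont(2) e unfolding continuous_at_eps_delta by blast
  obtain d3 where d3: "d3 > 0" "ball z d3 \<subseteq> U"
    using U z open_contains_ball by blast
  \<comment> \<open>The division by 3 leaves room: points of the square of side \<open>h\<close> are
    at distance at most \<open>2 * h\<close> from \<open>z\<close>.\<close>
  define h where "h = min d1 (min d2 d3) / 3"
  have h: "h > 0" using d1 d2 d3 by (simp add: h_def)
  have near: "dist (z + Complex x y) z < min d1 (min d2 d3)" if "0 \<le> x" "x \<le> h" "0 \<le> y" "y \<le> h" for x y
  proof -
    have "cmod (Complex x y) \<le> \<bar>x\<bar> + \<bar>y\<bar>"
      using cmod_le[of "Complex x y"] by simp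
    then show ?thesis using that h by (simp add: dist_norm h_def)
  qed
  have inU: "z + Complex x y \<in> U" if "0 \<le> x" "x \<le> h" "0 \<le> y" "y \<le> h" for x y
    using near[OF that] d3(2) by (auto simp: dist_commute)
  have X: "((\<lambda>x. g (z + Complex x y)) has_real_derivative g1 (z + Complex x y)) (at x)"
    if "partials_on U g g1 g2" "0 \<le> x" "x \<le> h" "0 \<le> y" "y \<le> h" for x y g g1 and g2 :: "complex \<Rightarrow> real"
  proof -
    have "((\<lambda>x. z + Complex x y) has_derivative (\<lambda>t. Complex t 0)) (at x)"
      unfolding Complex_eq by (auto intro!: derivative_eq_intros)
    moreover have "(g has_derivative (\<lambda>h. Re h *\<^sub>R g1 (z + Complex x y) + Im h *\<^sub>R g2 (z + Complex x y)))
        (at (z + Complex x y))"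
      using that inU by (auto simp: partials_on_def)
    ultimately have "((\<lambda>x. g (z + Complex x y)) has_derivative
       (\<lambda>t. Re (Complex t 0) *\<^sub>R g1 (z + Complex x y) + Im (Complex t 0) *\<^sub>R g2 (z + Complex x y))) (at x)"
      by (rule has_derivative_compose)
    then show ?thesis
      unfolding has_field_derivative_def by (rule has_derivative_eq_rhs) (auto simp: algebra_simps)
  qed
  have Y: "((\<lambda>y. g (z + Complex x y)) has_real_derivative g2 (z + Complex x y)) (at y)"
    if "partials_on U g g1 g2" "0 \<le> x" "x \<le> h" "0 \<le> y" "y \<le> h" for x y g g2 and g1 :: "complex \<Rightarrow> real"
  proof -
    have "((\<lambda>y. z + Complex x y) has_derivative (\<lambda>t. Complex 0 t)) (at y)"
      unfolding Complex_eq by (auto intro!: derivative_eq_intros)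
    moreover have "(g has_derivative (\<lambda>h. Re h *\<^sub>R g1 (z + Complex x y) + Im h *\<^sub>R g2 (z + Complex x y)))
        (at (z + Complex x y))"
      using that inU by (auto simp: partials_on_def)
    ultimately have "((\<lambda>y. g (z + Complex x y)) has_derivative
       (\<lambda>t. Re (Complex 0 t) *\<^sub>R g1 (z + Complex x y) + Im (Complex 0 t) *\<^sub>R g2 (z + Complex x y))) (at y)"
      by (rule has_derivative_compose)
    then show ?thesis
      unfolding has_field_derivative_def by (rule has_derivative_eq_rhs) (auto simp: algebra_simps)
  qed
  define D where "D = u (z + Complex h h) - u (z + Complex h 0) - u (z + Complex 0 h) + u (z + Complex 0 0)"
  obtain x1 where x1: "0 < x1" "x1 < h"
    "D = h * (a (z + Complex x1 h) - a (z + Complex x1 0))"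
  proof -
    have "\<exists>x. 0 < x \<and> x < h \<and>
        (u (z + Complex h h) - u (z + Complex h 0)) - (u (z + Complex 0 h) - u (z + Complex 0 0)) =
        (h - 0) * (a (z + Complex x h) - a (z + Complex x 0))"
      using h by (intro MVT2 DERIV_diff X[OF u]) auto
    then show thesis using that by (auto simp: D_def)
  qed
  obtain y1 where y1: "0 < y1" "y1 < h" "a (z + Complex x1 h) - a (z + Complex x1 0) = h * q (z + Complex x1 y1)"
  proof -
    have "\<exists>y. 0 < y \<and> y < h \<and>
        a (z + Complex x1 h) - a (z + Complex x1 0) = (h - 0) * q (z + Complex x1 y)"
      using h x1 by (intro MVT2 Y[OF a]) auto
    then show thesis using that by auto
  qed
  obtain y2 where y2: "0 < y2" "y2 < h"
    "D = h * (b (z + Complex h y2) - b (z + Complex 0 y2))"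
  proof -
    have "\<exists>y. 0 < y \<and> y < h \<and>
        (u (z + Complex h h) - u (z + Complex 0 h)) - (u (z + Complex h 0) - u (z + Complex 0 0)) =
        (h - 0) * (b (z + Complex h y) - b (z + Complex 0 y))"
      using h by (intro MVT2 DERIV_diff Y[OF u]) auto
    then show thesis using that by (auto simp: D_def)
  qed
  obtain x2 where x2: "0 < x2" "x2 < h" "b (z + Complex h y2) - b (z + Complex 0 y2) = h * r (z + Complex x2 y2)"
  proof -
    have "\<exists>x. 0 < x \<and> x < h \<and>
        b (z + Complex h y2) - b (z + Complex 0 y2) = (h - 0) * r (z + Complex x y2)"
      using h y2 by (intro MVT2 X[OF b]) auto
    then show thesis using that by auto
  qed
  have "q (z + Complex x1 y1) = r (z + Complex x2 y2)"
    using x1 y1 x2 y2 h by simp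
  moreover have "dist (q (z + Complex x1 y1)) (q z) < e"
    using near[of x1 y1] x1 y1 by (intro d1) simp
  moreover have "dist (r (z + Complex x2 y2)) (r z) < e"
    using near[of x2 y2] x2 y2 by (intro d2) simp
  ultimately show False
    unfolding dist_real_def e_def by argo
qed

text \<open>The function \<open>u_x - \<i> u_y\<close> is holomorphic: its Cauchy-Riemann equations
  are harmonicity of \<open>u\<close> and symmetry of the mixed derivatives. On a convex set it has
  a primitive, whose real part has the same gradient as \<open>u\<close> and so differs from it by a
  constant.\<close>

lemma harmonic_eq_Re_holomorphic:
  fixes u :: "complex \<Rightarrow> real"
  assumes U: "open U" "convex U" and u: "harmonic_map_on U u"
  obtains F where "\<And>z. z \<in> U \<Longrightarrow> (F has_field_derivative Complex (dx u z) (- dy u z)) (at z)"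
    "\<And>z. z \<in> U \<Longrightarrow> Re (F z) = u z"
proof -
  note H = harmonic_map_onD[OF u]
  let ?h = "\<lambda>z. Complex (dx u z) (- dy u z)"
  have hol: "?h holomorphic_on U"
  proof -
    have "(?h has_field_derivative Complex (dx (dx u) z) (- dy (dx u) z)) (at z)" if z: "z \<in> U" for z
    proof -
      have e: "dx (dy u) z = dy (dx u) z" "dy (dy u) z = - dx (dx u) z"
        using mixed_partials_eq[OF U(1) H(1,2,3) z] H(4)[OF z] by simp_all
      have "((\<lambda>z. Complex (dx u z) (- dy u z)) has_derivative
          (\<lambda>k. Complex (Re k *\<^sub>R dx (dx u) z + Im k *\<^sub>R dy (dx u) z) (- (Re k *\<^sub>R dx (dy u) z + Im k *\<^sub>R dy (dy u) z)))) (at z)"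
        using H(2,3) z unfolding partials_on_def Complex_eq
        by (auto intro!: derivative_eq_intros simp: algebra_simps)
      then show ?thesis
        unfolding has_field_derivative_def
        by (rule has_derivative_eq_rhs) (auto simp: e complex_eq_iff algebra_simps)
    qed
    then show ?thesis
      using U(1) holomorphic_on_open by blast
  qed
  obtain G where G: "\<And>z. z \<in> U \<Longrightarrow> (G has_field_derivative ?h z) (at z within U)"
    using holomorphic_convex_primitive'[OF U(2,1) hol] by blast
  have G': "(G has_field_derivative ?h z) (at z)" if "z \<in> U" for z
    using G[OF that] at_within_open[OF that U(1)] by simp
  have "((\<lambda>z. Re (G z) - u z) has_derivative (\<lambda>h. 0)) (at z within U)" if z: "z \<in> U" for z
  proof -
    have "((\<lambda>z. Re (G z) - u z) has_derivative
            (\<lambda>k. Re (?h z * k) - (Re k *\<^sub>R dx u z + Im k *\<^sub>R dy u z))) (at z)"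
      using G'[OF z] H(1) z unfolding partials_on_def has_field_derivative_def
      by (auto intro!: derivative_eq_intros)
    then have "((\<lambda>z. Re (G z) - u z) has_derivative (\<lambda>h. 0)) (at z)"
      by (rule has_derivative_eq_rhs) (auto simp: algebra_simps)
    then show ?thesis
      by (rule has_derivative_at_withinI)
  qed
  from has_derivative_zero_constant[OF U(2) this]
  obtain c where c: "\<And>z. z \<in> U \<Longrightarrow> Re (G z) - u z = c"
    by blast
  show thesis
  proof (rule that[of "\<lambda>z. G z - of_real c"])
    show "((\<lambda>z. G z - of_real c) has_field_derivative ?h z) (at z)" if "z \<in> U" for z
      using G'[OF that] by (auto intro!: derivative_eq_intros)
    show "Re (G z - of_real c) = u z" if "z \<in> U" for z
      using c[OF that] by simp
  qed
qed

text \<open>If \<open>u = Re F\<close>, then \<open>|exp F| = exp u\<close>, so Cauchy's estimate for \<open>exp F\<close> bounds \<open>F'\<close>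
  in terms of \<open>u\<close> alone.\<close>

lemma real_harmonic_gradient_bound:
  fixes u :: "complex \<Rightarrow> real"
  assumes U: "open U" "convex U" and u: "harmonic_map_on U u"
    and r: "r > 0" "cball z r \<subseteq> U" and M: "\<And>w. w \<in> cball z r \<Longrightarrow> \<bar>u w\<bar> \<le> M"
  shows "\<bar>dx u z\<bar> \<le> exp (2 * M) / r" "\<bar>dy u z\<bar> \<le> exp (2 * M) / r"
proof -
  obtain F where F: "\<And>z. z \<in> U \<Longrightarrow> (F has_field_derivative Complex (dx u z) (- dy u z)) (at z)"
    "\<And>z. z \<in> U \<Longrightarrow> Re (F z) = u z"
    using harmonic_eq_Re_holomorphic[OF U u] by blast
  have z: "z \<in> U" using r by auto
  have E: "((\<lambda>z. exp (F z)) has_field_derivative exp (F w) * Complex (dx u w) (- dy u w)) (at w)"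
    if "w \<in> U" for w
    using F(1)[OF that] by (auto intro!: derivative_eq_intros)
  have hol: "(\<lambda>z. exp (F z)) holomorphic_on cball z r"
    using E U(1) holomorphic_on_open r(2) holomorphic_on_subset by blast
  have "cmod ((deriv ^^ 1) (\<lambda>z. exp (F z)) z) \<le> fact 1 * exp M / r ^ 1"
  proof (rule Cauchy_inequality)
    show "(\<lambda>z. exp (F z)) holomorphic_on ball z r"
      using hol holomorphic_on_subset ball_subset_cball by blast
    show "continuous_on (cball z r) (\<lambda>z. exp (F z))"
      using hol holomorphic_on_imp_continuous_on by blast
    show "cmod (exp (F x)) \<le> exp M" if "cmod (z - x) = r" for x
    proof -
      have "x \<in> cball z r" using that by (simp add: dist_norm)
      then show ?thesis using M[of x] F(2)[of x] r by (auto simp: norm_exp_eq_Re)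
    qed
  qed (fact r)
  then have "exp (u z) * cmod (Complex (dx u z) (- dy u z)) \<le> exp M / r"
    using DERIV_imp_deriv[OF E[OF z]] by (simp add: norm_mult F(2)[OF z] norm_exp_eq_Re)
  \<comment> \<open>Cauchy's estimate contributes one factor \<open>exp M\<close>; dividing by
    \<open>exp (u z)\<close>, which is at least \<open>exp (- M)\<close>, contributes the
    second.\<close>
  moreover have "exp (- M) \<le> exp (u z)"
    using M[of z] r by simp
  ultimately have "exp (- M) * cmod (Complex (dx u z) (- dy u z)) \<le> exp M / r"
    by (meson mult_right_mono norm_ge_zero order_trans)
  then have "cmod (Complex (dx u z) (- dy u z)) \<le> exp (2 * M) / r"
    by (simp add: exp_minus field_simps mult_exp_exp)
  then show "\<bar>dx u z\<bar> \<le> exp (2 * M) / r" "\<bar>dy u z\<bar> \<le> exp (2 * M) / r"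
    using abs_Re_le_cmod[of "Complex (dx u z) (- dy u z)"] abs_Im_le_cmod[of "Complex (dx u z) (- dy u z)"]
    by simp_all
qed

lemma harmonic_gradient_bound:
  fixes f :: "complex \<Rightarrow> real ^ 'n"
  assumes U: "open U" "convex U" and f: "harmonic_map_on U f"
    and r: "r > 0" "cball z r \<subseteq> U" and M: "\<And>w. w \<in> cball z r \<Longrightarrow> norm (f w) \<le> M"
  shows "norm (dx f z) \<le> CARD('n) * (exp (2 * M) / r)" "norm (dy f z) \<le> CARD('n) * (exp (2 * M) / r)"
proof -
  have z: "z \<in> U" using r by auto
  have c: "\<bar>dx f z $ i\<bar> \<le> exp (2 * M) / r" "\<bar>dy f z $ i\<bar> \<le> exp (2 * M) / r" for i
  proof -
    note L = harmonic_map_on_linear[OF bounded_linear_vec_nth[of i] U(1) f]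
    have "\<bar>f w $ i\<bar> \<le> M" if "w \<in> cball z r" for w
      using M[OF that] component_le_norm_cart[of "f w" i] by linarith
    from real_harmonic_gradient_bound[OF U L(1) r this]
    show "\<bar>dx f z $ i\<bar> \<le> exp (2 * M) / r" "\<bar>dy f z $ i\<bar> \<le> exp (2 * M) / r"
      using L(2,3)[OF z] by auto
  qed
  have "norm (dx f z) \<le> (\<Sum>i\<in>UNIV. \<bar>dx f z $ i\<bar>)" "norm (dy f z) \<le> (\<Sum>i\<in>UNIV. \<bar>dy f z $ i\<bar>)"
    by (rule norm_le_l1_cart)+
  then show "norm (dx f z) \<le> CARD('n) * (exp (2 * M) / r)" "norm (dy f z) \<le> CARD('n) * (exp (2 * M) / r)"
    using sum_bounded_above[of UNIV "\<lambda>i. \<bar>dx f z $ i\<bar>", OF c(1)]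
      sum_bounded_above[of UNIV "\<lambda>i. \<bar>dy f z $ i\<bar>", OF c(2)] by simp_all
qed

lemma has_vector_derivative_componentwise_cart:
  fixes f :: "real \<Rightarrow> real ^ 'n"
  assumes "\<And>i. ((\<lambda>t. f t $ i) has_vector_derivative f' $ i) (at t within S)"
  shows "(f has_vector_derivative f') (at t within S)"
  using assms unfolding has_vector_derivative_def has_derivative_componentwise_within[of f]
  by (auto simp: Basis_vec_def inner_axis)

text \<open>Each component of \<open>f\<close> is the real part of a holomorphic function, and the
  iterated complex derivatives of that function yield the derivatives of every order along the
  segment. This makes images of segments admissible in \<open>minimal_pseudodist\<close>.\<close>

lemma smooth_on_interval_harmonic_segment:
  fixes f :: "complex \<Rightarrow> real ^ 'n"
  assumes U: "open U" "convex U" and f: "harmonic_map_on U f" and zw: "z \<in> U" "w \<in> U"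
  shows "smooth_on_interval 0 1 (\<lambda>t. f (z + of_real t * (w - z)))"
proof -
  define \<sigma> where "\<sigma> t = z + of_real t * (w - z)" for t
  have \<sigma>: "\<sigma> t \<in> U" if "t \<in> {0..1}" for t
  proof -
    have "\<sigma> t = (1 - t) *\<^sub>R z + t *\<^sub>R w"
      by (simp add: \<sigma>_def scaleR_conv_of_real algebra_simps)
    then show ?thesis
      using convexD_alt[OF U(2) zw, of t] that by simp
  qed
  have "\<exists>F. (\<forall>z\<in>U. (F has_field_derivative Complex (dx (\<lambda>z. f z $ i) z) (- dy (\<lambda>z. f z $ i) z)) (at z)) \<and>
         (\<forall>z\<in>U. Re (F z) = f z $ i)" for i
    using harmonic_eq_Re_holomorphic[OF U harmonic_map_on_linear(1)[OF bounded_linear_vec_nth[of i] U(1) f]]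
    by metis
  then obtain F where F: "\<And>i z. z \<in> U \<Longrightarrow> F i field_differentiable (at z)" "\<And>i z. z \<in> U \<Longrightarrow> Re (F i z) = f z $ i"
    unfolding field_differentiable_def by metis
  have hol: "F i holomorphic_on U" for i
    using F(1) field_differentiable_at_within holomorphic_on_def by blast
  \<comment> \<open>The case \<open>k = 0\<close> is separate because \<open>D 0\<close> has to
    equal the path at every real \<open>t\<close>, while \<open>Re (F i z) = f z $ i\<close> is
    known only on \<open>U\<close>.\<close>
  define D where "D k t = (if k = 0 then f (\<sigma> t) else
      (\<chi> i. Re ((w - z) ^ k * (deriv ^^ k) (F i) (\<sigma> t))))" for k t
  have D: "D k t = (\<chi> i. Re ((w - z) ^ k * (deriv ^^ k) (F i) (\<sigma> t)))" if "t \<in> {0..1}" for k t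
    using F(2)[OF \<sigma>[OF that]] by (simp add: D_def vec_eq_iff)
  have "(D k has_vector_derivative D (Suc k) t) (at t within {0..1})" if t: "t \<in> {0..1}" for k t
  proof -
    have "((\<lambda>t. Re ((w - z) ^ k * (deriv ^^ k) (F i) (\<sigma> t))) has_vector_derivative D (Suc k) t $ i)
           (at t within {0..1})" for i
    proof -
      have "((deriv ^^ k) (F i) has_field_derivative (deriv ^^ Suc k) (F i) (\<sigma> t)) (at (\<sigma> t))"
        using holomorphic_derivI[OF holomorphic_higher_deriv[OF hol U(1)] U(1) \<sigma>[OF t]] by simp
      then have fd: "((deriv ^^ k) (F i) has_field_derivative (deriv ^^ Suc k) (F i) (\<sigma> t))
          (at (\<sigma> t) within \<sigma> ` {0..1})"
        by (rule has_field_derivative_at_within)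
      have "(\<sigma> has_vector_derivative (w - z)) (at t within {0..1})"
        unfolding \<sigma>_def by (auto intro!: derivative_eq_intros)
      from field_vector_diff_chain_within[OF this fd]
      have "((\<lambda>t. (deriv ^^ k) (F i) (\<sigma> t)) has_vector_derivative
            (w - z) * (deriv ^^ Suc k) (F i) (\<sigma> t)) (at t within {0..1})"
        unfolding o_def .
      then have "((\<lambda>t. (w - z) ^ k * (deriv ^^ k) (F i) (\<sigma> t)) has_vector_derivative
            (w - z) ^ k * ((w - z) * (deriv ^^ Suc k) (F i) (\<sigma> t))) (at t within {0..1})"
        by (rule has_vector_derivative_mult_right)
      from bounded_linear.has_vector_derivative[OF bounded_linear_Re this]
      show ?thesis
        unfolding D[OF t] by (simp add: mult_ac)
    qed
    then have "((\<lambda>t. \<chi> i. Re ((w - z) ^ k * (deriv ^^ k) (F i) (\<sigma> t))) has_vector_derivative D (Suc k) t)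
           (at t within {0..1})"
      by (intro has_vector_derivative_componentwise_cart) simp
    then show ?thesis
      by (rule has_vector_derivative_transform[rotated 2]) (use t D in auto)
  qed
  moreover have "D 0 = (\<lambda>t. f (z + of_real t * (w - z)))"
    by (simp add: D_def \<sigma>_def fun_eq_iff)
  ultimately show ?thesis
    unfolding smooth_on_interval_def by blast
qed

section \<open>The minimal pseudometric\<close>

lemma minimal_pseudometric_le:
  assumes "f \<in> CH unit_disc \<Omega>" "f 0 = x" "dx f 0 = r *\<^sub>R v" "r > 0"
  shows "minimal_pseudometric \<Omega> x v \<le> 1 / r"
  unfolding minimal_pseudometric_def
  by (rule cInf_lower) (use assms in \<open>auto intro!: bdd_belowI[of _ 0]\<close>)

text \<open>In dimension at least 2 there is a vector \<open>w\<close> orthogonal to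
  \<open>v\<close> of the same norm. The linear map sending \<open>z\<close> to
  \<open>Re z *\<^sub>R v + Im z *\<^sub>R w\<close> then multiplies norms by \<open>norm v\<close>,
  so the unit disc is mapped into the ball of radius \<open>\<delta>\<close>.\<close>

lemma affine_disc_exists:
  fixes x v :: "'a::euclidean_space"
  assumes dim: "DIM('a) \<ge> 2" and \<delta>: "\<delta> > 0" "ball x \<delta> \<subseteq> \<Omega>" "norm v \<le> \<delta>"
  obtains f where "f \<in> CH unit_disc \<Omega>" "f 0 = x" "dx f 0 = v"
proof -
  obtain u where u: "u \<noteq> 0" "orthogonal v u"
    using orthogonal_to_vector_exists[OF dim] by blast
  define w where "w = (norm v / norm u) *\<^sub>R u"
  have w: "norm v = norm w" "v \<bullet> w = 0"
    using u by (simp_all add: w_def orthogonal_def)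
  have ww: "w \<bullet> w = v \<bullet> v" "w \<bullet> v = 0"
    using w by (simp_all add: norm_eq inner_commute)
  have "x + Re z *\<^sub>R v + Im z *\<^sub>R w \<in> \<Omega>" if z: "z \<in> unit_disc" for z
  proof -
    have "(norm (Re z *\<^sub>R v + Im z *\<^sub>R w))\<^sup>2 = ((Re z)\<^sup>2 + (Im z)\<^sup>2) * (v \<bullet> v)"
      unfolding power2_norm_eq_inner using w(2) ww
      by (simp add: inner_add_left inner_add_right power2_eq_square algebra_simps)
    also have "\<dots> = (norm z * norm v)\<^sup>2"
      by (simp add: power_mult_distrib cmod_power2 power2_norm_eq_inner)
    finally have "norm (Re z *\<^sub>R v + Im z *\<^sub>R w) = norm z * norm v"
      by (rule power2_eq_imp_eq) auto
    also have "\<dots> < \<delta>"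
    proof (cases "v = 0")
      case False
      then have "norm z * norm v < 1 * norm v"
        using z by (intro mult_strict_right_mono) auto
      then show ?thesis using \<delta> by simp
    qed (use \<delta> in simp)
    finally have "x + (Re z *\<^sub>R v + Im z *\<^sub>R w) \<in> ball x \<delta>"
      by (simp only: mem_ball dist_norm norm_minus_commute[of x] add_diff_cancel_left')
    then show ?thesis using \<delta>(2) by (auto simp: add.assoc)
  qed
  note CH = affine_map_in_CH[where U = unit_disc, OF open_ball w this]
  show thesis
    by (rule that[OF CH(1) _ CH(2)]) simp_all
qed

text \<open>Rules out a real \<open>Inf\<close> over the empty set, to which no lower bound could be
  transferred.\<close>

lemma minimal_pseudometric_set_nonempty:
  fixes x v :: "'a::euclidean_space"
  assumes dim: "DIM('a) \<ge> 2" and \<Omega>: "open \<Omega>" "x \<in> \<Omega>"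
  obtains r f where "r > 0" "f \<in> CH unit_disc \<Omega>" "f 0 = x" "dx f 0 = r *\<^sub>R v"
proof -
  obtain \<delta> where \<delta>: "\<delta> > 0" "ball x \<delta> \<subseteq> \<Omega>"
    using \<Omega> open_contains_ball by blast
  \<comment> \<open>The summand 1 keeps the denominator positive when \<open>v = 0\<close>.\<close>
  define r where "r = \<delta> / (norm v + 1)"
  have r: "r > 0" using \<delta> by (simp add: r_def add_nonneg_pos)
  have "norm (r *\<^sub>R v) \<le> \<delta>"
  proof -
    have "\<delta> * (norm v / (norm v + 1)) \<le> \<delta> * 1"
      using \<delta>(1) norm_ge_zero[of v] by (intro mult_left_mono) (auto simp: divide_le_eq simp del: norm_ge_zero)
    then show ?thesis using r by (simp del: times_divide_eq_right) (simp add: r_def)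
  qed
  from affine_disc_exists[OF dim \<delta> this] r that show thesis by blast
qed

lemma minimal_pseudometric_geI:
  fixes x v :: "'a::euclidean_space"
  assumes "DIM('a) \<ge> 2" "open \<Omega>" "x \<in> \<Omega>"
    and "\<And>r f. r > 0 \<Longrightarrow> f \<in> CH unit_disc \<Omega> \<Longrightarrow> f 0 = x \<Longrightarrow> dx f 0 = r *\<^sub>R v \<Longrightarrow> c \<le> 1 / r"
  shows "c \<le> minimal_pseudometric \<Omega> x v"
  unfolding minimal_pseudometric_def
proof (rule cInf_greatest)
  obtain r f where "r > 0" "f \<in> CH unit_disc \<Omega>" "f 0 = x" "dx f 0 = r *\<^sub>R v"
    using minimal_pseudometric_set_nonempty[OF assms(1-3)] by blast
  then show "{1 / r |r. r > 0 \<and> (\<exists>f\<in>CH unit_disc \<Omega>. f 0 = x \<and> dx f 0 = r *\<^sub>R v)} \<noteq> {}"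
    by blast
qed (use assms(4) in blast)

text \<open>A disc with vanishing derivative at 0 is admissible for every \<open>r\<close>, so
  \<open>1 / r\<close> can be made arbitrarily small.\<close>

lemma minimal_pseudometric_zero_le:
  fixes x :: "'a::euclidean_space"
  assumes "DIM('a) \<ge> 2" "open \<Omega>" "x \<in> \<Omega>"
  shows "minimal_pseudometric \<Omega> x 0 \<le> 0"
proof (rule field_le_epsilon)
  fix e :: real assume e: "e > 0"
  obtain \<delta> where \<delta>: "\<delta> > 0" "ball x \<delta> \<subseteq> \<Omega>"
    using assms open_contains_ball by blast
  obtain f where "f \<in> CH unit_disc \<Omega>" "f 0 = x" "dx f 0 = 0"
    using affine_disc_exists[OF assms(1) \<delta>, of 0] \<delta> by auto
  then have "minimal_pseudometric \<Omega> x 0 \<le> 1 / (1 / e)"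
    using e by (intro minimal_pseudometric_le) auto
  then show "minimal_pseudometric \<Omega> x 0 \<le> 0 + e" by simp
qed

lemma minimal_pseudometric_le_norm:
  fixes x v :: "'a::euclidean_space"
  assumes "DIM('a) \<ge> 2" "open \<Omega>" "\<delta> > 0" "ball x \<delta> \<subseteq> \<Omega>"
  shows "minimal_pseudometric \<Omega> x v \<le> norm v / \<delta>"
proof (cases "v = 0")
  case True
  then show ?thesis
    using minimal_pseudometric_zero_le[of \<Omega> x] assms centre_in_ball[of x \<delta>] by force
next
  case False
  then have "norm ((\<delta> / norm v) *\<^sub>R v) \<le> \<delta>"
    using assms by simp
  from affine_disc_exists[OF assms(1,3,4) this]
  obtain f where "f \<in> CH unit_disc \<Omega>" "f 0 = x" "dx f 0 = (\<delta> / norm v) *\<^sub>R v"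
    by blast
  then have "minimal_pseudometric \<Omega> x v \<le> 1 / (\<delta> / norm v)"
    using False assms by (intro minimal_pseudometric_le) auto
  then show ?thesis by simp
qed

lemma minimal_pseudometric_scale_le:
  fixes x v :: "'a::euclidean_space"
  assumes "DIM('a) \<ge> 2" "open \<Omega>" "x \<in> \<Omega>" "c > 0"
  shows "minimal_pseudometric \<Omega> x (c *\<^sub>R v) \<le> c * minimal_pseudometric \<Omega> x v"
proof -
  have "minimal_pseudometric \<Omega> x (c *\<^sub>R v) / c \<le> minimal_pseudometric \<Omega> x v"
  proof (rule minimal_pseudometric_geI[OF assms(1-3)])
    fix r f assume "r > 0" "f \<in> CH unit_disc \<Omega>" "f 0 = x" "dx f 0 = r *\<^sub>R v"
    then have "minimal_pseudometric \<Omega> x (c *\<^sub>R v) \<le> 1 / (r / c)"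
      using assms(4) by (intro minimal_pseudometric_le) auto
    then show "minimal_pseudometric \<Omega> x (c *\<^sub>R v) / c \<le> 1 / r"
      using assms(4) by (simp add: field_simps)
  qed
  then show ?thesis
    using assms(4) by (simp add: field_simps)
qed

lemma minimal_pseudometric_CH_le:
  fixes f :: "complex \<Rightarrow> 'a::euclidean_space"
  assumes dim: "DIM('a) \<ge> 2" and \<Omega>: "open \<Omega>" and f: "f \<in> CH unit_disc \<Omega>"
    and s: "norm z \<le> s" "s < 1"
  shows "minimal_pseudometric \<Omega> (f z) (Re c *\<^sub>R dx f z + Im c *\<^sub>R dy f z) \<le> norm c / (1 - s)"
proof (cases "c = 0")
  case True
  then show ?thesis
    using minimal_pseudometric_zero_le[OF dim \<Omega> CH_D(3)[OF f, of z]] s by simp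
next
  case False
  define r where "r = (1 - s) / norm c"
  have r: "r > 0" using False s by (simp add: r_def)
  \<comment> \<open>The modulus \<open>1 - s\<close> keeps the small disc around \<open>z\<close>
    inside the unit disc, and the argument of \<open>c\<close> turns its real axis into the
    direction \<open>c\<close>. The derivative at 0 becomes \<open>r\<close> times the derivative of
    \<open>f\<close> along \<open>c\<close>.\<close>
  define k where "k = of_real r * c"
  have k: "norm k = 1 - s" using False r by (simp add: k_def norm_mult) (simp add: r_def)
  have V: "z + k * \<zeta> \<in> unit_disc" if "\<zeta> \<in> unit_disc" for \<zeta>
  proof -
    have "norm (z + k * \<zeta>) \<le> norm z + norm k * norm \<zeta>"
      by (metis norm_mult norm_triangle_ineq)
    also have "\<dots> < s + (1 - s) * 1"
      using that s k by (intro add_le_less_mono mult_strict_left_mono) auto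
    finally show ?thesis by simp
  qed
  have "(\<lambda>\<zeta>. f (z + k * \<zeta>)) \<in> CH unit_disc \<Omega>"
    by (rule CH_affine[OF open_ball V f])
  moreover have "dx (\<lambda>\<zeta>. f (z + k * \<zeta>)) 0 = r *\<^sub>R (Re c *\<^sub>R dx f z + Im c *\<^sub>R dy f z)"
    using partials_on_eq(1)[OF partials_on_affine[OF CH_D(5)[OF f] V], of 0]
    by (simp add: k_def algebra_simps)
  ultimately have "minimal_pseudometric \<Omega> (f z) (Re c *\<^sub>R dx f z + Im c *\<^sub>R dy f z) \<le> 1 / r"
    using r by (intro minimal_pseudometric_le) auto
  then show ?thesis by (simp add: r_def)
qed

section \<open>Lengths of paths and the pseudodistance\<close>

text \<open>Hides the partition of \<open>piecewise_smooth_path\<close>, so that proofs go by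
  induction over the smooth pieces. The degenerate interval \<open>trivial\<close> allows a cut at
  either end.\<close>

inductive piecewise_smooth_on :: "(real \<Rightarrow> 'a::real_normed_vector) \<Rightarrow> real \<Rightarrow> real \<Rightarrow> bool"
  for \<gamma> where
  trivial: "piecewise_smooth_on \<gamma> a a"
| extend: "piecewise_smooth_on \<gamma> a c \<Longrightarrow> c < b \<Longrightarrow> smooth_on_interval c b \<gamma> \<Longrightarrow> piecewise_smooth_on \<gamma> a b"

lemma piecewise_smooth_on_le: "piecewise_smooth_on \<gamma> a b \<Longrightarrow> a \<le> b"
  by (induction rule: piecewise_smooth_on.induct) auto

lemma smooth_on_interval_subset:
  assumes "smooth_on_interval a b \<gamma>" "a \<le> c" "d \<le> b"
  shows "smooth_on_interval c d \<gamma>"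
proof -
  obtain D where D: "D 0 = \<gamma>"
    "\<And>k t. t \<in> {a..b} \<Longrightarrow> (D k has_vector_derivative D (Suc k) t) (at t within {a..b})"
    using assms(1) unfolding smooth_on_interval_def by blast
  have "{c..d} \<subseteq> {a..b}" using assms by auto
  with D show ?thesis
    unfolding smooth_on_interval_def
    by (intro exI[of _ D]) (blast intro: has_vector_derivative_within_subset)
qed

lemma smooth_on_interval_affine:
  assumes "smooth_on_interval a b \<gamma>" "c > 0"
  shows "smooth_on_interval ((a - d) / c) ((b - d) / c) (\<lambda>t. \<gamma> (c * t + d))"
proof -
  obtain D where D: "D 0 = \<gamma>"
    "\<And>k t. t \<in> {a..b} \<Longrightarrow> (D k has_vector_derivative D (Suc k) t) (at t within {a..b})"
    using assms(1) unfolding smooth_on_interval_def by blast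
  let ?I = "{(a - d) / c..(b - d) / c}"
  have "((\<lambda>t. c ^ k *\<^sub>R D k (c * t + d)) has_vector_derivative c ^ Suc k *\<^sub>R D (Suc k) (c * t + d)) (at t within ?I)"
    if t: "t \<in> ?I" for k t
  proof -
    have img: "(\<lambda>t. c * t + d) ` ?I \<subseteq> {a..b}"
      using assms(2) by (auto simp: field_simps)
    then have "(D k has_vector_derivative D (Suc k) (c * t + d)) (at (c * t + d) within (\<lambda>t. c * t + d) ` ?I)"
      using D(2)[of "c * t + d" k] t by (blast intro: has_vector_derivative_within_subset)
    moreover have "((\<lambda>t. c * t + d) has_vector_derivative c) (at t within ?I)"
      by (auto intro!: derivative_eq_intros)
    ultimately have "((\<lambda>t. D k (c * t + d)) has_vector_derivative c *\<^sub>R D (Suc k) (c * t + d)) (at t within ?I)"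
      using vector_diff_chain_within[of "\<lambda>t. c * t + d" c t ?I "D k"] by (simp add: o_def)
    then show ?thesis
      by (auto intro!: derivative_eq_intros)
  qed
  moreover have "(\<lambda>t. c ^ 0 *\<^sub>R D 0 (c * t + d)) = (\<lambda>t. \<gamma> (c * t + d))"
    using D(1) by simp
  ultimately show ?thesis
    unfolding smooth_on_interval_def by (intro exI[of _ "\<lambda>k t. c ^ k *\<^sub>R D k (c * t + d)"]) auto
qed

lemma piecewise_smooth_on_affine:
  assumes "piecewise_smooth_on \<gamma> a b" "c > 0"
  shows "piecewise_smooth_on (\<lambda>t. \<gamma> (c * t + d)) ((a - d) / c) ((b - d) / c)"
  using assms(1)
proof (induction rule: piecewise_smooth_on.induct)
  case (extend a e b)
  show ?case
    by (rule piecewise_smooth_on.extend[OF extend.IH _ smooth_on_interval_affine])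
       (use extend assms(2) in \<open>auto simp: divide_strict_right_mono\<close>)
qed (rule piecewise_smooth_on.trivial)

lemma piecewise_smooth_on_split:
  assumes "piecewise_smooth_on \<gamma> a b" "a \<le> t" "t \<le> b"
  shows "piecewise_smooth_on \<gamma> a t \<and> piecewise_smooth_on \<gamma> t b"
  using assms
proof (induction rule: piecewise_smooth_on.induct)
  case (trivial a)
  then have "t = a" by simp
  then show ?case by (simp add: piecewise_smooth_on.trivial)
next
  case (extend a c b)
  show ?case
  proof (cases "t \<le> c")
    case True
    then show ?thesis
      using extend piecewise_smooth_on.extend by blast
  next
    case False
    then have "piecewise_smooth_on \<gamma> a t"
      using extend smooth_on_interval_subset[of c b \<gamma> c t] piecewise_smooth_on.extend[of \<gamma> a c t] by auto
    moreover have "piecewise_smooth_on \<gamma> t b"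
    proof (cases "t = b")
      case False
      then show ?thesis
        using \<open>\<not> t \<le> c\<close> extend smooth_on_interval_subset[of c b \<gamma> t b]
        by (intro piecewise_smooth_on.extend[OF piecewise_smooth_on.trivial]) auto
    qed (simp add: piecewise_smooth_on.trivial)
    ultimately show ?thesis ..
  qed
qed

lemma piecewise_smooth_path_iff:
  "piecewise_smooth_path \<gamma> \<longleftrightarrow> path \<gamma> \<and> piecewise_smooth_on \<gamma> 0 1"
proof -
  have "\<exists>(m::nat) p. p 0 = a \<and> p m = b \<and> (\<forall>i<m. p i < p (Suc i) \<and> smooth_on_interval (p i) (p (Suc i)) \<gamma>)"
    if "piecewise_smooth_on \<gamma> a b" for a b
    using that
  proof (induction rule: piecewise_smooth_on.induct)
    case (trivial a)
    show ?case by (intro exI[of _ 0] exI[of _ "\<lambda>_. a"]) simp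
  next
    case (extend a c b)
    then obtain m :: nat and p where "p 0 = a" "p m = c"
      "\<And>i. i < m \<Longrightarrow> p i < p (Suc i) \<and> smooth_on_interval (p i) (p (Suc i)) \<gamma>"
      by blast
    then show ?case
      using extend by (intro exI[of _ "Suc m"] exI[of _ "p(Suc m := b)"]) (auto simp: less_Suc_eq)
  qed
  moreover have "piecewise_smooth_on \<gamma> (p 0) (p m)"
    if "\<forall>i<m. p i < p (Suc i) \<and> smooth_on_interval (p i) (p (Suc i)) \<gamma>" for m :: nat and p
    using that by (induction m) (auto intro: piecewise_smooth_on.intros)
  ultimately show ?thesis
    unfolding piecewise_smooth_path_def by metis
qed

lemma smooth_on_interval_C1:
  assumes "smooth_on_interval a b \<gamma>"
  obtains \<gamma>' where "continuous_on {a..b} \<gamma>'"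
    "\<And>t. t \<in> {a..b} \<Longrightarrow> (\<gamma> has_vector_derivative \<gamma>' t) (at t within {a..b})"
    "\<And>t. t \<in> {a<..<b} \<Longrightarrow> (\<gamma> has_vector_derivative \<gamma>' t) (at t)"
proof -
  obtain D where D: "D 0 = \<gamma>"
    "\<And>k t. t \<in> {a..b} \<Longrightarrow> (D k has_vector_derivative D (Suc k) t) (at t within {a..b})"
    using assms(1) unfolding smooth_on_interval_def by blast
  show thesis
  proof (rule that[of "D 1"])
    show "continuous_on {a..b} (D 1)"
      unfolding continuous_on_eq_continuous_within
      by (intro ballI, rule has_vector_derivative_continuous, rule D(2))
    show *: "(\<gamma> has_vector_derivative D 1 t) (at t within {a..b})" if "t \<in> {a..b}" for t
      using D(2)[OF that, of 0] D(1) by simp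
    show "(\<gamma> has_vector_derivative D 1 t) (at t)" if "t \<in> {a<..<b}" for t
      using *[of t] that by (simp add: at_within_Icc_at)
  qed
qed

lemma piecewise_smooth_on_differentiable:
  assumes "piecewise_smooth_on \<gamma> a b"
  shows "\<exists>S. finite S \<and> (\<forall>t\<in>{a..b} - S. \<gamma> differentiable (at t))"
  using assms
proof (induction rule: piecewise_smooth_on.induct)
  case (trivial a)
  show ?case by (intro exI[of _ "{a}"]) auto
next
  case (extend a c b)
  then obtain S where S: "finite S" "\<forall>t\<in>{a..c} - S. \<gamma> differentiable (at t)"
    by blast
  obtain \<gamma>' where \<gamma>': "\<And>t. t \<in> {c<..<b} \<Longrightarrow> (\<gamma> has_vector_derivative \<gamma>' t) (at t)"
    using smooth_on_interval_C1[OF extend(3)] by metis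
  have "\<gamma> differentiable (at t)" if "t \<in> {c<..<b}" for t
    by (rule differentiableI_vector[OF \<gamma>'[OF that]])
  then have "\<gamma> differentiable (at t)" if "t \<in> {a..b} - insert b (insert c S)" for t
    using S(2) that by (cases "t \<le> c") auto
  then show ?case using S(1) by (intro exI[of _ "insert b (insert c S)"]) simp
qed

section \<open>Lower integrals and lengths of paths\<close>

lemma AE_lborel_finiteI:
  assumes "finite (S :: real set)" "\<And>t. t \<notin> S \<Longrightarrow> P t"
  shows "AE t in lborel. P t"
  by (rule AE_I'[OF finite_imp_null_set_lborel[OF assms(1)]]) (use assms(2) in auto)

text \<open>The library has the next three facts for measurable functions
  only. The integrand of \<^const>\<open>minimal_length\<close> is not known to be measurable; the integral is then
  a lower integral, for which the inequalities persist in the stated direction.\<close>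

lemma nn_integral_affine_le:
  fixes f :: "real \<Rightarrow> ennreal"
  assumes c: "c > 0"
  shows "(\<integral>\<^sup>+ x. ennreal c * f (t + c * x) \<partial>lborel) \<le> (\<integral>\<^sup>+ x. f x \<partial>lborel)"
proof -
  have "integral\<^sup>S lborel h \<le> (\<integral>\<^sup>+ x. f x \<partial>lborel)"
    if h: "simple_function lborel h" "h \<le> (\<lambda>x. ennreal c * f (t + c * x))" for h
  proof -
    have [measurable]: "h \<in> borel_measurable borel"
      using borel_measurable_simple_function[OF h(1)] by simp
    \<comment> \<open>A simple function \<open>h\<close> is measurable, so the substitution holds
      for it with equality. Its transport \<open>k\<close> back to the original variable lies below
      \<open>f\<close>.\<close>
    define k where "k y = ennreal (1 / c) * h ((y - t) / c)" for y
    have cc: "ennreal (1 / c) * ennreal c = 1" "ennreal c * ennreal (1 / c) = 1"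
      using c by (simp_all flip: ennreal_mult')
    have "integral\<^sup>S lborel h = (\<integral>\<^sup>+ x. h x \<partial>lborel)"
      using h(1) by (simp add: nn_integral_eq_simple_integral)
    also have "\<dots> = (\<integral>\<^sup>+ x. ennreal c * k (t + c * x) \<partial>lborel)"
      using c cc by (simp add: k_def flip: mult.assoc)
    also have "\<dots> = ennreal c * (\<integral>\<^sup>+ x. k (t + c * x) \<partial>lborel)"
      unfolding k_def by (rule nn_integral_cmult) measurable
    also have "\<dots> = (\<integral>\<^sup>+ x. k x \<partial>lborel)"
    proof -
      have "k \<in> borel_measurable borel" unfolding k_def by measurable
      from nn_integral_real_affine[OF this, of c t] c show ?thesis by simp
    qed
    also have "\<dots> \<le> (\<integral>\<^sup>+ x. f x \<partial>lborel)"
    proof (rule nn_integral_mono)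
      fix y
      have "h ((y - t) / c) \<le> ennreal c * f y"
        using le_funD[OF h(2), of "(y - t) / c"] c by simp
      then have "k y \<le> ennreal (1 / c) * (ennreal c * f y)"
        unfolding k_def by (rule mult_left_mono) simp
      then show "k y \<le> f y"
        using cc by (simp flip: mult.assoc)
    qed
    finally show ?thesis .
  qed
  then show ?thesis
    unfolding nn_integral_def[of lborel "\<lambda>x. ennreal c * f (t + c * x)"] by (auto intro: SUP_least)
qed

lemma nn_integral_superadditive:
  "(\<integral>\<^sup>+ x. f x \<partial>M) + (\<integral>\<^sup>+ x. g x \<partial>M) \<le> (\<integral>\<^sup>+ x. f x + g x \<partial>M)"
proof -
  let ?S = "\<lambda>f. {h. simple_function M h \<and> h \<le> f}"
  have ne: "?S f \<noteq> {}" for f :: "'a \<Rightarrow> ennreal"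
    by (auto intro!: exI[of _ "\<lambda>_. 0"] simp: le_fun_def)
  have "integral\<^sup>S M h + integral\<^sup>S M k \<le> (\<integral>\<^sup>+ x. f x + g x \<partial>M)" if "h \<in> ?S f" "k \<in> ?S g" for h k
  proof -
    have "integral\<^sup>S M h + integral\<^sup>S M k = integral\<^sup>S M (\<lambda>x. h x + k x)"
      using that by simp
    also have "\<dots> \<le> (\<integral>\<^sup>+ x. f x + g x \<partial>M)"
      unfolding nn_integral_def
      by (rule SUP_upper) (use that in \<open>auto simp: le_fun_def intro: add_mono\<close>)
    finally show ?thesis .
  qed
  moreover have "(\<integral>\<^sup>+ x. f x \<partial>M) + integral\<^sup>S M k = (SUP h\<in>?S f. integral\<^sup>S M h + integral\<^sup>S M k)" for k
    unfolding nn_integral_def[of M f] by (rule ennreal_SUP_add_left[OF ne, symmetric])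
  ultimately have "(\<integral>\<^sup>+ x. f x \<partial>M) + integral\<^sup>S M k \<le> (\<integral>\<^sup>+ x. f x + g x \<partial>M)" if "k \<in> ?S g" for k
    using that by (auto intro!: SUP_least)
  moreover have "(\<integral>\<^sup>+ x. f x \<partial>M) + (\<integral>\<^sup>+ x. g x \<partial>M) = (SUP k\<in>?S g. (\<integral>\<^sup>+ x. f x \<partial>M) + integral\<^sup>S M k)"
    unfolding nn_integral_def[of M g] by (rule ennreal_SUP_add_right[OF ne])
  ultimately show ?thesis
    by (auto intro!: SUP_least)
qed

lemma nn_integral_cmult_ge: "c * (\<integral>\<^sup>+ x. f x \<partial>M) \<le> (\<integral>\<^sup>+ x. c * f x \<partial>M)"
proof -
  have "c * (\<integral>\<^sup>+ x. f x \<partial>M) = (SUP h\<in>{h. simple_function M h \<and> h \<le> f}. c * integral\<^sup>S M h)"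
    unfolding nn_integral_def by (rule SUP_mult_left_ennreal)
  also have "\<dots> \<le> (\<integral>\<^sup>+ x. c * f x \<partial>M)"
  proof (rule SUP_least)
    fix h assume h: "h \<in> {h. simple_function M h \<and> h \<le> f}"
    then have "c * integral\<^sup>S M h = integral\<^sup>S M (\<lambda>x. c * h x)"
      by (simp add: simple_integral_mult)
    also have "\<dots> \<le> (\<integral>\<^sup>+ x. c * f x \<partial>M)"
      unfolding nn_integral_def
      by (rule SUP_upper) (use h in \<open>auto simp: le_fun_def intro: mult_left_mono\<close>)
    finally show "c * integral\<^sup>S M h \<le> (\<integral>\<^sup>+ x. c * f x \<partial>M)" .
  qed
  finally show ?thesis .
qed

lemma nn_integral_Icc_superadditive:
  fixes f :: "real \<Rightarrow> ennreal"
  assumes "a \<le> t" "t \<le> b"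
  shows "(\<integral>\<^sup>+ x\<in>{a..t}. f x \<partial>lborel) + (\<integral>\<^sup>+ x\<in>{t..b}. f x \<partial>lborel) \<le> (\<integral>\<^sup>+ x\<in>{a..b}. f x \<partial>lborel)"
proof -
  have "(\<integral>\<^sup>+ x\<in>{a..t}. f x \<partial>lborel) + (\<integral>\<^sup>+ x\<in>{t..b}. f x \<partial>lborel) \<le>
        (\<integral>\<^sup>+ x. f x * indicator {a..t} x + f x * indicator {t..b} x \<partial>lborel)"
    by (rule nn_integral_superadditive)
  also have "\<dots> = (\<integral>\<^sup>+ x\<in>{a..b}. f x \<partial>lborel)"
  proof (rule nn_integral_cong_AE)
    show "AE x in lborel. f x * indicator {a..t} x + f x * indicator {t..b} x = f x * indicator {a..b} x"
      by (rule AE_lborel_finiteI[of "{t}"]) (use assms in \<open>auto simp: indicator_def\<close>)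
  qed
  finally show ?thesis .
qed

text \<open>A chord is no longer than the path. On each smooth piece the derivative, one-sided at
  the ends, is continuous, so the fundamental theorem of calculus applies. The ends of the pieces,
  where \<open>vector_derivative\<close> may have any value, form a null set.\<close>

lemma piecewise_smooth_on_norm_le:
  fixes \<gamma> :: "real \<Rightarrow> 'a::euclidean_space"
  assumes "piecewise_smooth_on \<gamma> a b"
  shows "ennreal (norm (\<gamma> b - \<gamma> a)) \<le> (\<integral>\<^sup>+ t\<in>{a..b}. ennreal (norm (vector_derivative \<gamma> (at t))) \<partial>lborel)"
  using assms
proof (induction rule: piecewise_smooth_on.induct)
  case (extend a c b)
  obtain \<gamma>' where \<gamma>': "continuous_on {c..b} \<gamma>'"
    "\<And>t. t \<in> {c..b} \<Longrightarrow> (\<gamma> has_vector_derivative \<gamma>' t) (at t within {c..b})"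
    "\<And>t. t \<in> {c<..<b} \<Longrightarrow> (\<gamma> has_vector_derivative \<gamma>' t) (at t)"
    using smooth_on_interval_C1[OF extend(3)] by blast
  have I: "(\<gamma>' has_integral (\<gamma> b - \<gamma> c)) {c..b}"
    using \<gamma>'(2) extend(2) by (intro fundamental_theorem_of_calculus) auto
  have N: "(\<lambda>t. norm (\<gamma>' t)) integrable_on {c..b}"
    using \<gamma>'(1) by (intro integrable_continuous_interval continuous_on_norm)
  have "norm (\<gamma> b - \<gamma> c) \<le> integral {c..b} (\<lambda>t. norm (\<gamma>' t))"
    using integral_norm_bound_integral[OF has_integral_integrable[OF I] N] integral_unique[OF I] by simp
  then have "ennreal (norm (\<gamma> b - \<gamma> c)) \<le> ennreal (integral {c..b} (\<lambda>t. norm (\<gamma>' t)))"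
    by (rule ennreal_leI)
  also have "\<dots> = (\<integral>\<^sup>+ t\<in>{c..b}. ennreal (norm (\<gamma>' t)) \<partial>lborel)"
    using N by (intro nn_integral_has_integral_lebesgue'[symmetric]) auto
  also have "\<dots> = (\<integral>\<^sup>+ t\<in>{c..b}. ennreal (norm (vector_derivative \<gamma> (at t))) \<partial>lborel)"
  proof (rule nn_integral_cong_AE)
    have "ennreal (norm (\<gamma>' t)) * indicator {c..b} t = ennreal (norm (vector_derivative \<gamma> (at t))) * indicator {c..b} t"
      if "t \<notin> {c, b}" for t
      using \<gamma>'(3)[of t, THEN vector_derivative_at] that by (auto simp: indicator_def)
    then show "AE t in lborel. ennreal (norm (\<gamma>' t)) * indicator {c..b} t =
                 ennreal (norm (vector_derivative \<gamma> (at t))) * indicator {c..b} t"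
      by (intro AE_lborel_finiteI[of "{c, b}"]) auto
  qed
  finally have cb: "ennreal (norm (\<gamma> b - \<gamma> c)) \<le> (\<integral>\<^sup>+ t\<in>{c..b}. ennreal (norm (vector_derivative \<gamma> (at t))) \<partial>lborel)" .
  have "ennreal (norm (\<gamma> b - \<gamma> a)) \<le> ennreal (norm (\<gamma> c - \<gamma> a)) + ennreal (norm (\<gamma> b - \<gamma> c))"
    using norm_triangle_ineq[of "\<gamma> c - \<gamma> a" "\<gamma> b - \<gamma> c"] by (simp flip: ennreal_plus add: ennreal_leI)
  also have "\<dots> \<le> (\<integral>\<^sup>+ t\<in>{a..c}. ennreal (norm (vector_derivative \<gamma> (at t))) \<partial>lborel) +
      (\<integral>\<^sup>+ t\<in>{c..b}. ennreal (norm (vector_derivative \<gamma> (at t))) \<partial>lborel)"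
    using extend.IH cb by (rule add_mono)
  also have "\<dots> \<le> (\<integral>\<^sup>+ t\<in>{a..b}. ennreal (norm (vector_derivative \<gamma> (at t))) \<partial>lborel)"
    using extend(2) piecewise_smooth_on_le[OF extend(1)] by (intro nn_integral_Icc_superadditive) auto
  finally show ?case .
qed simp

lemma minimal_length_eq:
  "minimal_length \<Omega> \<gamma> = (\<integral>\<^sup>+ t\<in>{0..1}. ennreal (minimal_pseudometric \<Omega> (\<gamma> t) (vector_derivative \<gamma> (at t))) \<partial>lborel)"
  unfolding minimal_length_def
proof (rule nn_integral_cong_AE)
  have "at t within {0..1} = at t" if "t \<notin> {0, 1}" "t \<in> {0..1}" for t :: real
    using that by (simp add: at_within_Icc_at)
  then show "AE t in lborel. ennreal (minimal_pseudometric \<Omega> (\<gamma> t) (vector_derivative \<gamma> (at t within {0..1}))) * indicator {0..1} t =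
      ennreal (minimal_pseudometric \<Omega> (\<gamma> t) (vector_derivative \<gamma> (at t))) * indicator {0..1} t"
    by (intro AE_lborel_finiteI[of "{0, 1}"]) (auto simp: indicator_def)
qed

text \<open>Reparametrization multiplies the velocity by \<open>c = v - u\<close>. Homogeneity of
  the pseudometric extracts this factor, which is also the Jacobian of the substitution. The chain
  rule may fail only at the finitely many times sent to points of \<open>S\<close>, where
  \<open>\<gamma>\<close> need not be differentiable.\<close>

lemma minimal_length_subpath_le:
  fixes \<gamma> :: "real \<Rightarrow> 'a::euclidean_space"
  assumes dim: "DIM('a) \<ge> 2" and \<Omega>: "open \<Omega>" "path_image \<gamma> \<subseteq> \<Omega>"
    and \<gamma>: "piecewise_smooth_path \<gamma>" and uv: "0 \<le> u" "u < v" "v \<le> 1"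
  shows "minimal_length \<Omega> (subpath u v \<gamma>) \<le>
    (\<integral>\<^sup>+ t\<in>{u..v}. ennreal (minimal_pseudometric \<Omega> (\<gamma> t) (vector_derivative \<gamma> (at t))) \<partial>lborel)"
proof -
  define c where "c = v - u"
  have c: "c > 0" using uv by (simp add: c_def)
  define F where "F t = ennreal (minimal_pseudometric \<Omega> (\<gamma> t) (vector_derivative \<gamma> (at t))) * indicator {u..v} t" for t
  obtain S where S: "finite S" "\<And>t. t \<in> {0..1} - S \<Longrightarrow> \<gamma> differentiable (at t)"
    using piecewise_smooth_on_differentiable[of \<gamma> 0 1] \<gamma> piecewise_smooth_path_iff[of \<gamma>] by auto
  have "minimal_length \<Omega> (subpath u v \<gamma>) \<le> (\<integral>\<^sup>+ x. ennreal c * F (u + c * x) \<partial>lborel)"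
    unfolding minimal_length_eq
  proof (rule nn_integral_mono_AE)
    have "ennreal (minimal_pseudometric \<Omega> (subpath u v \<gamma> t) (vector_derivative (subpath u v \<gamma>) (at t))) * indicator {0..1} t
        \<le> ennreal c * F (u + c * t)" if t: "t \<notin> (\<lambda>s. (s - u) / c) ` S" for t
    proof (cases "t \<in> {0..1}")
      case True
      have "c * t \<le> c * 1" "0 \<le> c * t"
        using True c by (auto intro: mult_left_mono)
      then have I: "u + c * t \<in> {u..v}"
        by (simp add: c_def)
      have "u + c * t \<notin> S"
        using t c by (force simp: image_iff)
      then have "(\<gamma> has_vector_derivative vector_derivative \<gamma> (at (u + c * t))) (at (u + c * t))"
        using S(2)[of "u + c * t"] I uv vector_derivative_works by auto
      moreover have "((\<lambda>t. u + c * t) has_vector_derivative c) (at t)"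
        by (auto intro!: derivative_eq_intros)
      ultimately have "((\<lambda>t. \<gamma> (u + c * t)) has_vector_derivative c *\<^sub>R vector_derivative \<gamma> (at (u + c * t))) (at t)"
        using vector_diff_chain_at[of "\<lambda>t. u + c * t" c t \<gamma>] by (simp add: o_def)
      then have e: "vector_derivative (subpath u v \<gamma>) (at t) = c *\<^sub>R vector_derivative \<gamma> (at (u + c * t))"
        by (intro vector_derivative_at) (simp add: subpath_def c_def add.commute)
      have "\<gamma> (u + c * t) \<in> \<Omega>"
        using I uv \<Omega>(2) by (auto simp: path_image_def)
      from minimal_pseudometric_scale_le[OF dim \<Omega>(1) this c]
      show ?thesis
        using True I c unfolding e
        by (simp add: F_def ennreal_leI subpath_def c_def add.commute flip: ennreal_mult')
    qed simp
    then show "AE t in lborel. ennreal (minimal_pseudometric \<Omega> (subpath u v \<gamma> t) (vector_derivative (subpath u v \<gamma>) (at t))) * indicator {0..1} t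
        \<le> ennreal c * F (u + c * t)"
      by (rule AE_lborel_finiteI[OF finite_imageI[OF S(1)]])
  qed
  also have "\<dots> \<le> (\<integral>\<^sup>+ t. F t \<partial>lborel)"
    by (rule nn_integral_affine_le[OF c])
  finally show ?thesis unfolding F_def .
qed

section \<open>Upper bounds for the pseudodistance\<close>

lemma minimal_pseudodist_le_length:
  assumes "piecewise_smooth_path \<gamma>" "path_image \<gamma> \<subseteq> \<Omega>" "pathstart \<gamma> = x" "pathfinish \<gamma> = y"
  shows "minimal_pseudodist \<Omega> x y \<le> minimal_length \<Omega> \<gamma>"
  unfolding minimal_pseudodist_def by (rule INF_lower) (use assms in simp)

lemma smooth_path: "path \<gamma> \<Longrightarrow> smooth_on_interval 0 1 \<gamma> \<Longrightarrow> piecewise_smooth_path \<gamma>"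
  unfolding piecewise_smooth_path_iff
  by (auto intro: piecewise_smooth_on.extend[OF piecewise_smooth_on.trivial])

lemma smooth_on_interval_linepath: "smooth_on_interval a b (linepath x y)"
proof -
  let ?D = "\<lambda>k t. if k = 0 then linepath x y t else if k = 1 then y - x else 0"
  have "(linepath x y has_vector_derivative y - x) (at t within A)" for t A
    unfolding linepath_def by (auto intro!: derivative_eq_intros simp: algebra_simps)
  then show ?thesis
    unfolding smooth_on_interval_def
    by (intro exI[of _ ?D]) (auto simp: fun_eq_iff)
qed

lemma minimal_length_le_const:
  assumes "\<And>t. t \<in> {0<..<1} \<Longrightarrow> minimal_pseudometric \<Omega> (\<gamma> t) (vector_derivative \<gamma> (at t)) \<le> C"
  shows "minimal_length \<Omega> \<gamma> \<le> ennreal C"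
proof -
  have "minimal_length \<Omega> \<gamma> \<le> (\<integral>\<^sup>+ t. ennreal C * indicator {0..1::real} t \<partial>lborel)"
    unfolding minimal_length_eq
  proof (rule nn_integral_mono_AE)
    show "AE t in lborel. ennreal (minimal_pseudometric \<Omega> (\<gamma> t) (vector_derivative \<gamma> (at t))) * indicator {0..1} t
            \<le> ennreal C * indicator {0..1::real} t"
    proof (rule AE_lborel_finiteI[of "{0, 1}"])
      show "ennreal (minimal_pseudometric \<Omega> (\<gamma> t) (vector_derivative \<gamma> (at t))) * indicator {0..1} t
              \<le> ennreal C * indicator {0..1::real} t" if "t \<notin> {0, 1}" for t
        using assms[of t] that by (auto simp: indicator_def intro: ennreal_leI)
    qed simp
  qed
  also have "\<dots> = ennreal C" by (simp add: nn_integral_cmult_indicator)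
  finally show ?thesis .
qed

text \<open>The factor 2 makes the ball of radius \<open>\<delta>\<close> around every point of the
  segment lie in \<Omega>, so one bound \<open>norm v / \<delta>\<close> for the pseudometric is
  valid along the whole segment.\<close>

lemma minimal_pseudodist_segment_le:
  fixes x :: "'a::euclidean_space"
  assumes dim: "DIM('a) \<ge> 2" and \<Omega>: "open \<Omega>" "ball p (2 * \<delta>) \<subseteq> \<Omega>"
    and xy: "x \<in> ball p \<delta>" "y \<in> ball p \<delta>"
  shows "minimal_pseudodist \<Omega> x y \<le> ennreal (norm (y - x) / \<delta>)"
proof -
  have \<delta>: "\<delta> > 0" using xy zero_le_dist[of p x] by (simp del: zero_le_dist)
  have img: "path_image (linepath x y) \<subseteq> ball p \<delta>"
    using xy convex_ball[of p \<delta>] by (simp add: closed_segment_subset)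
  have sub: "ball q \<delta> \<subseteq> \<Omega>" if "q \<in> ball p \<delta>" for q
  proof -
    have "dist p z < 2 * \<delta>" if "dist q z < \<delta>" for z
      using \<open>q \<in> ball p \<delta>\<close> that dist_triangle[of p z q] by simp
    then show ?thesis using \<Omega>(2) by auto
  qed
  have "minimal_pseudodist \<Omega> x y \<le> minimal_length \<Omega> (linepath x y)"
  proof (rule minimal_pseudodist_le_length)
    show "path_image (linepath x y) \<subseteq> \<Omega>"
      using img sub \<delta> centre_in_ball by blast
  qed (simp_all add: smooth_path smooth_on_interval_linepath)
  also have "\<dots> \<le> ennreal (norm (y - x) / \<delta>)"
  proof (rule minimal_length_le_const)
    fix t :: real assume t: "t \<in> {0<..<1}"
    have "(linepath x y has_vector_derivative y - x) (at t)"
      unfolding linepath_def by (auto intro!: derivative_eq_intros simp: algebra_simps)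
    then have "vector_derivative (linepath x y) (at t) = y - x"
      by (rule vector_derivative_at)
    moreover have "linepath x y t \<in> ball p \<delta>"
      using t img unfolding path_image_def by (meson atLeastAtMost_iff greaterThanLessThan_iff image_subset_iff less_imp_le)
    ultimately show "minimal_pseudometric \<Omega> (linepath x y t) (vector_derivative (linepath x y) (at t)) \<le> norm (y - x) / \<delta>"
      using minimal_pseudometric_le_norm[OF dim \<Omega>(1) \<delta> sub] by simp
  qed
  finally show ?thesis .
qed

lemma minimal_pseudodist_self:
  fixes x :: "'a::euclidean_space"
  assumes dim: "DIM('a) \<ge> 2" and \<Omega>: "open \<Omega>" "x \<in> \<Omega>"
  shows "minimal_pseudodist \<Omega> x x = 0"
proof -
  obtain e where "e > 0" "ball x e \<subseteq> \<Omega>"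
    using \<Omega> open_contains_ball by blast
  then show ?thesis
    using minimal_pseudodist_segment_le[OF dim \<Omega>(1), of x "e / 2" x x] by simp
qed

lemma minimal_pseudodist_le_integral:
  fixes \<gamma> :: "real \<Rightarrow> 'a::euclidean_space"
  assumes dim: "DIM('a) \<ge> 2" and \<Omega>: "open \<Omega>" "path_image \<gamma> \<subseteq> \<Omega>"
    and \<gamma>: "piecewise_smooth_path \<gamma>" and uv: "0 \<le> u" "u \<le> v" "v \<le> 1"
  shows "minimal_pseudodist \<Omega> (\<gamma> u) (\<gamma> v) \<le>
    (\<integral>\<^sup>+ t\<in>{u..v}. ennreal (minimal_pseudometric \<Omega> (\<gamma> t) (vector_derivative \<gamma> (at t))) \<partial>lborel)"
proof (cases "u = v")
  case True
  have "\<gamma> v \<in> \<Omega>" using uv \<Omega>(2) by (auto simp: path_image_def)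
  then show ?thesis using True minimal_pseudodist_self[OF dim \<Omega>(1)] by simp
next
  case False
  then have uv': "u < v" using uv by simp
  have "minimal_pseudodist \<Omega> (\<gamma> u) (\<gamma> v) \<le> minimal_length \<Omega> (subpath u v \<gamma>)"
  proof (rule minimal_pseudodist_le_length)
    have p: "path \<gamma>" "piecewise_smooth_on \<gamma> 0 1"
      using \<gamma> by (auto simp: piecewise_smooth_path_iff)
    have "piecewise_smooth_on \<gamma> u v"
      using piecewise_smooth_on_split[of \<gamma> 0 1 u] piecewise_smooth_on_split[of \<gamma> u 1 v] p(2) uv by auto
    from piecewise_smooth_on_affine[OF this, of "v - u" u] uv'
    show "piecewise_smooth_path (subpath u v \<gamma>)"
      unfolding piecewise_smooth_path_iff using p(1) uv by (simp add: subpath_def path_subpath[unfolded subpath_def])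
    show "path_image (subpath u v \<gamma>) \<subseteq> \<Omega>"
      using path_image_subpath_subset[of u v \<gamma>] \<Omega>(2) uv by auto
  qed simp_all
  also note minimal_length_subpath_le[OF dim \<Omega> \<gamma> uv(1) uv' uv(3)]
  finally show ?thesis .
qed

text \<open>Points on a nearly shortest path are nearly between its ends. Only the superadditivity
  of the lower integral enters.\<close>

lemma minimal_pseudodist_add_le_length:
  fixes \<gamma> :: "real \<Rightarrow> 'a::euclidean_space"
  assumes dim: "DIM('a) \<ge> 2" and \<Omega>: "open \<Omega>" "path_image \<gamma> \<subseteq> \<Omega>"
    and \<gamma>: "piecewise_smooth_path \<gamma>" and t: "0 \<le> t" "t \<le> 1"
  shows "minimal_pseudodist \<Omega> (\<gamma> 0) (\<gamma> t) + minimal_pseudodist \<Omega> (\<gamma> t) (\<gamma> 1) \<le> minimal_length \<Omega> \<gamma>"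
  unfolding minimal_length_eq
  using add_mono[OF minimal_pseudodist_le_integral[OF dim \<Omega> \<gamma>, of 0 t] minimal_pseudodist_le_integral[OF dim \<Omega> \<gamma>, of t 1]]
    nn_integral_Icc_superadditive[OF t] t order_trans by fastforce

text \<open>The segment from \<open>z\<close> to \<open>w\<close> stays in the convex disc of radius
  \<open>s\<close>, where \<open>minimal_pseudometric_CH_le\<close> bounds the speed of its image
  under \<open>f\<close> by a constant.\<close>

lemma minimal_pseudodist_CH_le:
  fixes f :: "complex \<Rightarrow> real ^ 'n"
  assumes dim: "CARD('n) \<ge> 2" and \<Omega>: "open \<Omega>" and f: "f \<in> CH unit_disc \<Omega>"
    and s: "norm z \<le> s" "norm w \<le> s" "s < 1"
  shows "minimal_pseudodist \<Omega> (f z) (f w) \<le> ennreal (norm (w - z) / (1 - s))"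
proof -
  define \<sigma> where "\<sigma> t = z + of_real t * (w - z)" for t
  have \<sigma>: "norm (\<sigma> t) \<le> s" if "t \<in> {0..1}" for t
  proof -
    have "\<sigma> t = (1 - t) *\<^sub>R z + t *\<^sub>R w"
      by (simp add: \<sigma>_def scaleR_conv_of_real algebra_simps)
    then show ?thesis
      using convexD_alt[OF convex_cball[of 0 s], of z w t] s that by simp
  qed
  have \<sigma>': "(\<sigma> has_vector_derivative (w - z)) (at t)" for t
    unfolding \<sigma>_def by (auto intro!: derivative_eq_intros)
  have "minimal_pseudodist \<Omega> (f z) (f w) \<le> minimal_length \<Omega> (\<lambda>t. f (\<sigma> t))"
  proof (rule minimal_pseudodist_le_length)
    have "continuous_on {0..1} (\<lambda>t. f (\<sigma> t))"
    proof (rule continuous_on_compose2[OF CH_D(4)[OF f]])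
      show "continuous_on {0..1} \<sigma>"
        unfolding \<sigma>_def by (intro continuous_intros)
      show "\<sigma> ` {0..1} \<subseteq> unit_disc"
        using \<sigma> s(3) by fastforce
    qed
    moreover have "smooth_on_interval 0 1 (\<lambda>t. f (\<sigma> t))"
      unfolding \<sigma>_def using s
      by (intro smooth_on_interval_harmonic_segment[OF open_ball convex_ball CH_D(1)[OF f]]) auto
    ultimately show "piecewise_smooth_path (\<lambda>t. f (\<sigma> t))"
      by (intro smooth_path) (simp_all add: path_def)
    have "f (\<sigma> t) \<in> \<Omega>" if "t \<in> {0..1}" for t
      using \<sigma>[OF that] s(3) by (intro CH_D(3)[OF f]) simp
    then show "path_image (\<lambda>t. f (\<sigma> t)) \<subseteq> \<Omega>"
      by (auto simp: path_image_def)
  qed (simp_all add: pathstart_def pathfinish_def \<sigma>_def)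
  also have "\<dots> \<le> ennreal (norm (w - z) / (1 - s))"
  proof (rule minimal_length_le_const)
    fix t :: real assume t: "t \<in> {0<..<1}"
    have st: "norm (\<sigma> t) \<le> s" using t \<sigma>[of t] by simp
    then have "(f has_derivative (\<lambda>h. Re h *\<^sub>R dx f (\<sigma> t) + Im h *\<^sub>R dy f (\<sigma> t))) (at (\<sigma> t))"
      using CH_D(5)[OF f] s(3) by (simp add: partials_on_def)
    from has_derivative_compose[OF \<sigma>'[unfolded has_vector_derivative_def] this]
    have "((\<lambda>t. f (\<sigma> t)) has_vector_derivative (Re (w - z) *\<^sub>R dx f (\<sigma> t) + Im (w - z) *\<^sub>R dy f (\<sigma> t))) (at t)"
      unfolding has_vector_derivative_def by (rule has_derivative_eq_rhs) (auto simp: algebra_simps)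
    then show "minimal_pseudometric \<Omega> (f (\<sigma> t)) (vector_derivative (\<lambda>t. f (\<sigma> t)) (at t)) \<le> norm (w - z) / (1 - s)"
      using minimal_pseudometric_CH_le[OF _ \<Omega> f st s(3), of "w - z"] dim
      by (simp add: vector_derivative_at)
  qed
  finally show ?thesis .
qed

section \<open>Taut domains are hyperbolic\<close>

text \<open>Convergence of the values is enough and no derivative of the limit is considered:
  uniform convergence bounds the tail of the subsequence on a fixed disc, and the harmonic gradient
  estimate turns this into a bound for the derivatives at 0.\<close>

lemma taut_imp_gradient_bound:
  fixes \<Omega> :: "(real ^ 'n) set"
  assumes taut: "taut \<Omega>" and K: "compact K'" "K' \<subseteq> \<Omega>"
  obtains C where "C > 0" "\<And>f. f \<in> CH unit_disc \<Omega> \<Longrightarrow> f 0 \<in> K' \<Longrightarrow> norm (dx f 0) \<le> C"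
proof (rule ccontr)
  assume *: "\<not> thesis"
  have "\<exists>f. f \<in> CH unit_disc \<Omega> \<and> f 0 \<in> K' \<and> norm (dx f 0) > Suc n" for n
    using * that[of "real (Suc n)"] by (force simp: not_le)
  then obtain f where f: "\<And>n. f n \<in> CH unit_disc \<Omega>" "\<And>n. f n 0 \<in> K'" "\<And>n. norm (dx (f n) 0) > Suc n"
    by metis
  then have "range f \<subseteq> CH unit_disc \<Omega>" by blast
  then obtain r :: "nat \<Rightarrow> nat" where r: "strict_mono r"
    "(\<exists>g. g ` unit_disc \<subseteq> \<Omega> \<and> (\<forall>K. compact K \<and> K \<subseteq> unit_disc \<longrightarrow> uniform_limit K (f \<circ> r) g sequentially)) \<or>
     compactly_divergent unit_disc \<Omega> (f \<circ> r)"
    using taut[unfolded taut_def normal_family_def, THEN spec[of _ f]] by (auto simp only: simp_thms)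
  have "\<not> compactly_divergent unit_disc \<Omega> (f \<circ> r)"
  proof
    assume "compactly_divergent unit_disc \<Omega> (f \<circ> r)"
    then have "finite {i. (f \<circ> r) i ` {0} \<inter> K' \<noteq> {}}"
      unfolding compactly_divergent_def using K by (elim allE[of _ "{0}"] allE[of _ K']) simp
    moreover have "{i. (f \<circ> r) i ` {0} \<inter> K' \<noteq> {}} = UNIV"
      using f(2) by auto
    ultimately show False by simp
  qed
  with r(2) obtain g where g: "\<And>K. compact K \<Longrightarrow> K \<subseteq> unit_disc \<Longrightarrow> uniform_limit K (f \<circ> r) g sequentially"
    by blast
  let ?B = "cball (0::complex) (1/2)"
  have sub: "?B \<subseteq> unit_disc" by auto
  have "\<forall>\<^sub>F n in sequentially. \<forall>z\<in>?B. dist ((f \<circ> r) n z) (g z) < 1"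
    using g[OF compact_cball sub] by (rule uniform_limitD) simp
  then obtain N where N': "\<forall>n\<ge>N. \<forall>z\<in>?B. dist ((f \<circ> r) n z) (g z) < 1"
    unfolding eventually_sequentially by blast
  have N: "dist (f (r n) z) (g z) < 1" if "n \<ge> N" "z \<in> ?B" for n z
    using N' that by (metis comp_apply)
  have "compact (f (r N) ` ?B)"
    using CH_D(4)[OF f(1)] sub by (intro compact_continuous_image) (auto intro: continuous_on_subset)
  then obtain B where B: "\<And>z. z \<in> ?B \<Longrightarrow> norm (f (r N) z) \<le> B"
    using compact_imp_bounded bounded_iff by (metis imageI)
  \<comment> \<open>On the disc of radius \<open>1/2\<close> the map \<open>f (r N)\<close> is
    bounded by \<open>B\<close>. Every later map differs from it by less than 2, as both are within
    1 of \<open>g\<close>.\<close>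
  define C where "C = CARD('n) * (exp (2 * (B + 2)) / (1/2))"
  have C: "norm (dx (f (r n)) 0) \<le> C" if n: "n \<ge> N" for n
    unfolding C_def
  proof (rule harmonic_gradient_bound(1)[OF open_ball convex_ball CH_D(1)[OF f(1)] _ sub])
    fix w :: complex assume w: "w \<in> ?B"
    have "dist (f (r n) w) (f (r N) w) < 2"
      using N[OF n w] N[OF le_refl w] dist_triangle_half_l by force
    then show "norm (f (r n) w) \<le> B + 2"
      using B[OF w] norm_triangle_ineq2[of "f (r n) w" "f (r N) w"] by (simp add: dist_norm)
  qed simp
  obtain n0 :: nat where "real n0 > C"
    using reals_Archimedean2 by blast
  then obtain n where n: "n \<ge> N" "real n > C"
    by (intro that[of "max N n0"]) auto
  have "real n \<le> real (r n)"
    using seq_suble[OF r(1)] by simp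
  then show False
    using C[OF n(1)] n(2) f(3)[of "r n"] by simp
qed

lemma taut_imp_hyperbolic:
  fixes \<Omega> :: "(real ^ 'n) set"
  assumes dim: "CARD('n) \<ge> 2" and \<Omega>: "open \<Omega>" and taut: "taut \<Omega>"
  shows "hyperbolic \<Omega>"
  unfolding hyperbolic_def
proof (intro ballI impI)
  fix x y assume x: "x \<in> \<Omega>" and "y \<in> \<Omega>" and ne: "x \<noteq> y"
  obtain e where e: "e > 0" "cball x e \<subseteq> \<Omega>"
    using \<Omega> x open_contains_cball by blast
  obtain C where C: "C > 0" "\<And>f. f \<in> CH unit_disc \<Omega> \<Longrightarrow> f 0 \<in> cball x e \<Longrightarrow> norm (dx f 0) \<le> C"
    using taut_imp_gradient_bound[OF taut compact_cball e(2)] by blast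
  have lower: "norm v / C \<le> minimal_pseudometric \<Omega> z v" if z: "z \<in> cball x e" for z v
  proof (rule minimal_pseudometric_geI[OF _ \<Omega>])
    fix r f assume "r > 0" "f \<in> CH unit_disc \<Omega>" "f 0 = z" "dx f 0 = r *\<^sub>R v"
    then have "r * norm v \<le> C"
      using C(2)[of f] z by simp
    then show "norm v / C \<le> 1 / r"
      using C(1) \<open>r > 0\<close> by (simp add: field_simps)
  qed (use z e dim in auto)
  \<comment> \<open>The bound by \<open>e\<close> keeps the path where \<open>lower\<close> holds
    until it reaches distance \<open>\<epsilon>\<close> from \<open>x\<close>; the bound by
    \<open>norm (y - x)\<close> forces it to reach that distance.\<close>
  define \<epsilon> where "\<epsilon> = min e (norm (y - x))"
  have \<epsilon>: "\<epsilon> > 0" "\<epsilon> \<le> e" "\<epsilon> \<le> norm (y - x)"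
    using e ne by (auto simp: \<epsilon>_def)
  have "ennreal (\<epsilon> / C) \<le> minimal_pseudodist \<Omega> x y"
    unfolding minimal_pseudodist_def
  proof (rule INF_greatest)
    fix \<gamma> assume "\<gamma> \<in> {\<gamma>. piecewise_smooth_path \<gamma> \<and> path_image \<gamma> \<subseteq> \<Omega> \<and> pathstart \<gamma> = x \<and> pathfinish \<gamma> = y}"
    then have \<gamma>: "piecewise_smooth_path \<gamma>" "\<gamma> 0 = x" "\<gamma> 1 = y"
      by (auto simp: pathstart_def pathfinish_def)
    then have cont: "continuous_on {0..1} \<gamma>" and pw: "piecewise_smooth_on \<gamma> 0 1"
      by (auto simp: piecewise_smooth_path_iff path_def)
    \<comment> \<open>The least element of \<open>T\<close> is the first time the path is at
      distance \<open>\<epsilon>\<close> or more from \<open>x\<close>. The part before it has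
      Euclidean length at least \<open>\<epsilon>\<close>.\<close>
    define T where "T = {t \<in> {0..1}. \<epsilon> \<le> norm (\<gamma> t - x)}"
    have "compact T"
    proof -
      have "closedin (top_of_set {0..1}) ({0..1} \<inter> (\<lambda>t. norm (\<gamma> t - x)) -` {\<epsilon>..})"
        using cont by (intro continuous_closedin_preimage continuous_intros) auto
      moreover have "T = {0..1} \<inter> (\<lambda>t. norm (\<gamma> t - x)) -` {\<epsilon>..}"
        by (auto simp: T_def)
      ultimately show ?thesis
        using closedin_compact[OF compact_Icc] by simp
    qed
    moreover have "1 \<in> T"
      using \<epsilon> \<gamma> by (simp add: T_def)
    ultimately obtain t where t: "t \<in> T" "\<And>s. s \<in> T \<Longrightarrow> t \<le> s"
      using compact_attains_inf[of T] by blast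
    have t01: "0 \<le> t" "t \<le> 1" using t(1) by (auto simp: T_def)
    have in_ball: "\<gamma> s \<in> cball x e" if "0 \<le> s" "s < t" for s
      using t(2)[of s] that t01 \<epsilon>(2) by (force simp: T_def dist_norm norm_minus_commute)
    have "ennreal (\<epsilon> / C) \<le> ennreal (1 / C) * ennreal (norm (\<gamma> t - \<gamma> 0))"
      using t(1) C(1) \<gamma> by (auto simp: T_def divide_right_mono intro!: ennreal_leI simp flip: ennreal_mult')
    also have "\<dots> \<le> ennreal (1 / C) * (\<integral>\<^sup>+ s\<in>{0..t}. ennreal (norm (vector_derivative \<gamma> (at s))) \<partial>lborel)"
      using piecewise_smooth_on_norm_le[of \<gamma> 0 t] piecewise_smooth_on_split[OF pw t01]
      by (intro mult_left_mono) auto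
    also have "\<dots> \<le> (\<integral>\<^sup>+ s. ennreal (1 / C) * (ennreal (norm (vector_derivative \<gamma> (at s))) * indicator {0..t} s) \<partial>lborel)"
      by (rule nn_integral_cmult_ge)
    also have "\<dots> \<le> minimal_length \<Omega> \<gamma>"
      unfolding minimal_length_eq
    \<comment> \<open>The fact \<open>in_ball\<close> concerns times strictly before
      \<open>t\<close>; the single time \<open>t\<close> is a null set.\<close>
    proof (rule nn_integral_mono_AE, rule AE_lborel_finiteI[of "{t}"])
      fix s assume "s \<notin> {t}"
      then show "ennreal (1 / C) * (ennreal (norm (vector_derivative \<gamma> (at s))) * indicator {0..t} s)
          \<le> ennreal (minimal_pseudometric \<Omega> (\<gamma> s) (vector_derivative \<gamma> (at s))) * indicator {0..1} s"
        using lower[OF in_ball[of s]] t01 C(1)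
        by (auto simp: indicator_def intro!: ennreal_leI simp flip: ennreal_mult')
    qed simp
    finally show "ennreal (\<epsilon> / C) \<le> minimal_length \<Omega> \<gamma>" .
  qed
  moreover have "ennreal (\<epsilon> / C) > 0"
    using \<epsilon> C by simp
  ultimately show "minimal_pseudodist \<Omega> x y > 0"
    by order
qed

section \<open>Complete hyperbolic domains are taut\<close>

text \<open>Supplies the equicontinuity for Arzela-Ascoli. Discs of radius \<open>s' - s\<close>
  around points of the smaller disc stay where \<open>M\<close> bounds \<open>f\<close>, so one
  gradient bound serves for all these points; the factor 2 adds the contributions of both partial
  derivatives.\<close>

lemma harmonic_locally_Lipschitz:
  fixes f :: "complex \<Rightarrow> real ^ 'n"
  assumes f: "harmonic_map_on unit_disc f" and s: "s < s'" "s' < 1"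
    and M: "\<And>z. norm z \<le> s' \<Longrightarrow> norm (f z) \<le> M"
    and zw: "norm z \<le> s" "norm w \<le> s"
  shows "norm (f w - f z) \<le> 2 * (CARD('n) * (exp (2 * M) / (s' - s))) * norm (w - z)"
proof -
  define L where "L = CARD('n) * (exp (2 * M) / (s' - s))"
  have sub: "cball 0 s \<subseteq> unit_disc" using s by auto
  have L: "norm (dx f \<zeta>) \<le> L" "norm (dy f \<zeta>) \<le> L" if \<zeta>: "norm \<zeta> \<le> s" for \<zeta>
  proof -
    have n: "norm v \<le> s'" if "v \<in> cball \<zeta> (s' - s)" for v
      using that \<zeta> norm_triangle_sub[of v \<zeta>] by (simp add: dist_norm norm_minus_commute)
    then have "cball \<zeta> (s' - s) \<subseteq> unit_disc" using s by fastforce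
    from harmonic_gradient_bound[OF open_ball convex_ball f _ this, of M] M n s(1)
    show "norm (dx f \<zeta>) \<le> L" "norm (dy f \<zeta>) \<le> L"
      unfolding L_def by auto
  qed
  have "norm (f w - f z) \<le> (2 * L) * norm (w - z)"
  proof (rule differentiable_bound[OF convex_cball[of 0 s]])
    fix \<zeta> assume \<zeta>: "\<zeta> \<in> cball (0::complex) s"
    show "(f has_derivative (\<lambda>h. Re h *\<^sub>R dx f \<zeta> + Im h *\<^sub>R dy f \<zeta>)) (at \<zeta> within cball 0 s)"
      using harmonic_map_onD(1)[OF f] \<zeta> sub unfolding partials_on_def
      by (blast intro: has_derivative_at_withinI)
    show "onorm (\<lambda>h. Re h *\<^sub>R dx f \<zeta> + Im h *\<^sub>R dy f \<zeta>) \<le> 2 * L"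
    proof (rule onorm_le)
      fix h
      have "norm (Re h *\<^sub>R dx f \<zeta> + Im h *\<^sub>R dy f \<zeta>) \<le> \<bar>Re h\<bar> * norm (dx f \<zeta>) + \<bar>Im h\<bar> * norm (dy f \<zeta>)"
        using norm_triangle_ineq[of "Re h *\<^sub>R dx f \<zeta>" "Im h *\<^sub>R dy f \<zeta>"] by simp
      also have "\<dots> \<le> norm h * L + norm h * L"
        using L[of \<zeta>] \<zeta> by (intro add_mono mult_mono abs_Re_le_cmod abs_Im_le_cmod) auto
      finally show "norm (Re h *\<^sub>R dx f \<zeta> + Im h *\<^sub>R dy f \<zeta>) \<le> 2 * L * norm h"
        by (simp add: algebra_simps)
    qed
  qed (use zw in auto)
  then show ?thesis unfolding L_def .
qed

text \<open>Arzela-Ascoli is applied on each disc of an exhaustion, and a diagonal subsequence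
  converges on all of them.\<close>

lemma harmonic_Montel:
  fixes f :: "nat \<Rightarrow> complex \<Rightarrow> real ^ 'n"
  assumes f: "\<And>n. harmonic_map_on unit_disc (f n)"
    and bound: "\<And>s. s < 1 \<Longrightarrow> \<exists>M. \<forall>n z. norm z \<le> s \<longrightarrow> norm (f n z) \<le> M"
  obtains g r where "strict_mono (r :: nat \<Rightarrow> nat)"
    "\<And>K. compact K \<Longrightarrow> K \<subseteq> unit_disc \<Longrightarrow> uniform_limit K (f \<circ> r) g sequentially"
proof -
  define s where "s i = 1 - 1 / (real i + 2)" for i
  have s: "s i < 1" for i by (simp add: s_def)
  let ?P = "\<lambda>i r. \<exists>g. uniform_limit (cball 0 (s i)) (\<lambda>n. f (r n)) g sequentially"
  have sub: "\<exists>k. strict_mono (k :: nat \<Rightarrow> nat) \<and> ?P i (r \<circ> k)" for i and r :: "nat \<Rightarrow> nat"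
  proof -
    define s' where "s' = (s i + 1) / 2"
    have s': "s i < s'" "s' < 1" using s[of i] by (auto simp: s'_def)
    obtain M where M: "\<And>n z. norm z \<le> s' \<Longrightarrow> norm (f n z) \<le> M"
      using bound[OF s'(2)] by blast
    define L where "L = 2 * (CARD('n) * (exp (2 * M) / (s' - s i)))"
    have L: "norm (f n w - f n z) \<le> L * norm (w - z)" if "norm z \<le> s i" "norm w \<le> s i" for n z w
      unfolding L_def by (rule harmonic_locally_Lipschitz[OF f s' M that])
    have L0: "L > 0" using s' by (simp add: L_def)
    obtain g k where gk: "strict_mono (k :: nat \<Rightarrow> nat)"
      "\<And>e. 0 < e \<Longrightarrow> \<exists>N. \<forall>n x. n \<ge> N \<and> x \<in> cball 0 (s i) \<longrightarrow> norm (f (r (k n)) x - g x) < e"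
    proof (rule Arzela_Ascoli[of "cball 0 (s i)" "\<lambda>n. f (r n)" M])
      show "norm (f (r n) x) \<le> M" if "x \<in> cball 0 (s i)" for n x
        using that s'(1) by (intro M) simp
      show "\<exists>d>0. \<forall>n y. y \<in> cball 0 (s i) \<and> norm (x - y) < d \<longrightarrow> norm (f (r n) x - f (r n) y) < e"
        if x: "x \<in> cball 0 (s i)" and e: "0 < e" for x e
      proof (intro exI[of _ "e / L"] conjI allI impI)
        fix n y assume y: "y \<in> cball 0 (s i) \<and> norm (x - y) < e / L"
        have "norm (f (r n) x - f (r n) y) \<le> L * norm (x - y)"
          using x y by (intro L) auto
        also have "\<dots> < e" using y L0 by (simp add: field_simps)
        finally show "norm (f (r n) x - f (r n) y) < e" .
      qed (use e L0 in simp)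
    qed auto
    have "uniform_limit (cball 0 (s i)) (\<lambda>n. f ((r \<circ> k) n)) g sequentially"
      unfolding uniform_limit_iff eventually_sequentially dist_norm o_apply using gk(2) by meson
    with gk(1) show ?thesis by blast
  qed
  obtain k where k: "strict_mono (k :: nat \<Rightarrow> nat)" "\<And>i. ?P i (id \<circ> k)"
  proof (rule subsequence_diagonalization_lemma[of ?P id, OF sub])
    \<comment> \<open>The diagonal lemma also asks that convergence survive the passage from
      \<open>k1\<close> to any \<open>k2\<close> whose late terms are terms of \<open>k1\<close> at
      the same or a later index.\<close>
    fix i N and r k1 k2 :: "nat \<Rightarrow> nat"
    assume P: "?P i (r \<circ> k1)" and sub: "\<And>j. N \<le> j \<Longrightarrow> \<exists>j'\<ge>j. k2 j = k1 j'"
    from P obtain g where g: "uniform_limit (cball 0 (s i)) (\<lambda>n. f ((r \<circ> k1) n)) g sequentially"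
      by blast
    have "uniform_limit (cball 0 (s i)) (\<lambda>n. f ((r \<circ> k2) n)) g sequentially"
      unfolding uniform_limit_iff eventually_sequentially
    proof (intro allI impI)
      fix e :: real assume "e > 0"
      then obtain N' where N': "\<forall>n\<ge>N'. \<forall>x\<in>cball 0 (s i). dist (f ((r \<circ> k1) n) x) (g x) < e"
        using g unfolding uniform_limit_iff eventually_sequentially by blast
      have "dist (f (r (k2 n)) x) (g x) < e" if n: "n \<ge> max N N'" and x: "x \<in> cball 0 (s i)" for n x
      proof -
        obtain j' where "j' \<ge> n" "k2 n = k1 j'" using sub[of n] n by auto
        then show ?thesis using N'[THEN spec[of _ j']] n x by simp
      qed
      then show "\<exists>N. \<forall>n\<ge>N. \<forall>x\<in>cball 0 (s i). dist (f ((r \<circ> k2) n) x) (g x) < e"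
        by (intro exI[of _ "max N N'"]) auto
    qed
    then show "?P i (r \<circ> k2)" by blast
  qed auto
  then obtain G where G: "\<And>i. uniform_limit (cball 0 (s i)) (\<lambda>n. f (k n)) (G i) sequentially"
    by (auto simp: o_def) metis
  \<comment> \<open>The limits \<open>G i\<close> were obtained separately for each disc; the
    pointwise limit agrees with each of them on its disc and thereby glues them.\<close>
  define g where "g z = lim (\<lambda>n. f (k n) z)" for z
  have gG: "g z = G i z" if "z \<in> cball 0 (s i)" for i z
    unfolding g_def using tendsto_uniform_limitI[OF G that] by (rule limI)
  show thesis
  proof (rule that[OF k(1), of g])
    fix K :: "complex set" assume K: "compact K" "K \<subseteq> unit_disc"
    have "\<exists>i. K \<subseteq> cball 0 (s i)"
    proof (cases "K = {}")
      case False
      obtain z0 where z0: "z0 \<in> K" "\<And>z. z \<in> K \<Longrightarrow> norm z \<le> norm z0"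
        using continuous_attains_sup[OF K(1) False, of norm] by (auto intro: continuous_intros)
      then have "1 - norm z0 > 0" using K by auto
      then obtain i where i: "inverse (real (Suc i)) < 1 - norm z0"
        using reals_Archimedean by blast
      have "1 / (real i + 2) \<le> inverse (real (Suc i))"
        by (simp add: field_simps)
      then have "norm z0 \<le> s i" using i by (simp add: s_def)
      then show ?thesis using z0(2) by (intro exI[of _ i]) force
    qed simp
    then obtain i where i: "K \<subseteq> cball 0 (s i)" by blast
    have "uniform_limit K (\<lambda>n. f (k n)) (G i) sequentially"
      using uniform_limit_on_subset[OF G i] .
    then show "uniform_limit K (f \<circ> k) g sequentially"
      using gG i by (subst uniform_limit_cong'[of K _ "\<lambda>n. f (k n)" g "G i"]) auto
  qed
qed

section \<open>The minimal distance as a length metric and the Hopf-Rinow theorem\<close>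

locale minimal_metric_space =
  Metric_space \<Omega> "\<lambda>x y. enn2real (minimal_pseudodist \<Omega> x y)" for \<Omega> :: "(real ^ 'n) set" +
  assumes dim: "CARD('n) \<ge> 2" and open_domain: "open \<Omega>"
begin

abbreviation \<rho> where "\<rho> x y \<equiv> enn2real (minimal_pseudodist \<Omega> x y)"

lemma dim': "DIM(real ^ 'n) \<ge> 2"
  using dim by simp

text \<open>\<open>enn2real\<close> sends an infinite value to 0, so an infinite pseudodistance
  between distinct points would contradict the metric axiom \<open>zero\<close>.\<close>

lemma ennreal_\<rho>:
  assumes "x \<in> \<Omega>" "y \<in> \<Omega>"
  shows "ennreal (\<rho> x y) = minimal_pseudodist \<Omega> x y"
proof (cases "x = y")
  case True
  then show ?thesis using minimal_pseudodist_self[OF dim' open_domain] assms by simp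
next
  case False
  then have "minimal_pseudodist \<Omega> x y \<noteq> top"
    using zero[OF assms] by auto
  then show ?thesis by (simp add: less_top)
qed

lemma \<rho>_le_iff:
  assumes "x \<in> \<Omega>" "y \<in> \<Omega>" "c \<ge> 0"
  shows "\<rho> x y \<le> c \<longleftrightarrow> minimal_pseudodist \<Omega> x y \<le> ennreal c"
  using ennreal_\<rho>[OF assms(1,2)] assms(3) by (metis ennreal_le_iff)

lemma \<rho>_less_iff:
  assumes "x \<in> \<Omega>" "y \<in> \<Omega>"
  shows "\<rho> x y < c \<longleftrightarrow> minimal_pseudodist \<Omega> x y < ennreal c"
  using ennreal_\<rho>[OF assms] by (metis ennreal_less_iff enn2real_nonneg)

lemma \<rho>_locally_le:
  assumes "p \<in> \<Omega>"
  obtains \<delta> where "\<delta> > 0" "ball p \<delta> \<subseteq> \<Omega>" "\<And>y. y \<in> ball p \<delta> \<Longrightarrow> \<rho> p y \<le> dist p y / \<delta>"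
proof -
  obtain e where e: "e > 0" "ball p e \<subseteq> \<Omega>"
    using open_domain assms open_contains_ball by blast
  show thesis
  proof (rule that[of "e / 2"])
    show sub: "ball p (e / 2) \<subseteq> \<Omega>" using e subset_ball[of "e / 2" e p] by auto
    show "\<rho> p y \<le> dist p y / (e / 2)" if y: "y \<in> ball p (e / 2)" for y
      using minimal_pseudodist_segment_le[OF dim' open_domain, of p "e / 2" p y] e y sub assms
      by (subst \<rho>_le_iff) (auto simp: dist_norm norm_minus_commute)
  qed (use e in simp)
qed

lemma continuous_on_\<rho>:
  assumes x: "x \<in> \<Omega>"
  shows "continuous_on \<Omega> (\<lambda>y. \<rho> x y)"
  unfolding continuous_on_iff
proof (intro ballI allI impI)
  fix p e assume p: "p \<in> \<Omega>" and e: "(0::real) < e"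
  obtain \<delta> where \<delta>: "\<delta> > 0" "ball p \<delta> \<subseteq> \<Omega>" "\<And>y. y \<in> ball p \<delta> \<Longrightarrow> \<rho> p y \<le> dist p y / \<delta>"
    using \<rho>_locally_le[OF p] by blast
  show "\<exists>d>0. \<forall>y\<in>\<Omega>. dist y p < d \<longrightarrow> dist (\<rho> x y) (\<rho> x p) < e"
  proof (intro exI[of _ "min \<delta> (\<delta> * e)"] conjI ballI impI)
    fix y assume y: "y \<in> \<Omega>" "dist y p < min \<delta> (\<delta> * e)"
    have "\<rho> p y \<le> dist p y / \<delta>"
      using y by (intro \<delta>) (simp add: dist_commute)
    also have "\<dots> < e"
      using y \<delta>(1) by (simp add: divide_less_eq dist_commute mult.commute)
    finally have "\<rho> p y < e" .
    then show "dist (\<rho> x y) (\<rho> x p) < e"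
      using triangle[OF x p y(1)] triangle[OF x y(1) p] commute[of y p] by (simp add: dist_real_def)
  qed (use \<delta> e in simp)
qed

text \<open>The length structure of \<open>\<rho>\<close> in a form free of integrals;
  \<open>mball_subset_ball\<close> and \<open>intermediate_point\<close> both rest on it.\<close>

lemma path_length_lt:
  assumes "x \<in> \<Omega>" "y \<in> \<Omega>" "\<rho> x y < c"
  obtains \<gamma> :: "real \<Rightarrow> real ^ 'n" where "path \<gamma>" "path_image \<gamma> \<subseteq> \<Omega>" "pathstart \<gamma> = x" "pathfinish \<gamma> = y"
    "\<forall>t\<in>{0..1}. \<rho> x (\<gamma> t) + \<rho> (\<gamma> t) y < c"
proof -
  have c: "c > 0" using assms(3) enn2real_nonneg[of "minimal_pseudodist \<Omega> x y"] by linarith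
  have "minimal_pseudodist \<Omega> x y < ennreal c"
    using assms \<rho>_less_iff by blast
  then obtain \<gamma> where \<gamma>: "piecewise_smooth_path \<gamma>" "path_image \<gamma> \<subseteq> \<Omega>" "\<gamma> 0 = x" "\<gamma> 1 = y"
    "minimal_length \<Omega> \<gamma> < ennreal c"
    unfolding minimal_pseudodist_def INF_less_iff by (auto simp: pathstart_def pathfinish_def)
  show thesis
  proof (rule that[of \<gamma>])
    have sub: "\<gamma> ` {0..1} \<subseteq> \<Omega>" using \<gamma>(2) by (simp add: path_image_def)
    show "\<forall>t\<in>{0..1}. \<rho> x (\<gamma> t) + \<rho> (\<gamma> t) y < c"
    proof
      fix t :: real assume t: "t \<in> {0..1}"
      then have "\<gamma> t \<in> \<Omega>" using sub by auto
      then have "ennreal (\<rho> x (\<gamma> t) + \<rho> (\<gamma> t) y) = minimal_pseudodist \<Omega> x (\<gamma> t) + minimal_pseudodist \<Omega> (\<gamma> t) y"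
        using assms ennreal_\<rho> by (simp add: ennreal_plus)
      also have "\<dots> < ennreal c"
        using minimal_pseudodist_add_le_length[OF dim' open_domain \<gamma>(2,1), of t] \<gamma>(3-5) t by simp
      finally have "ennreal (\<rho> x (\<gamma> t) + \<rho> (\<gamma> t) y) < ennreal c" .
      moreover have "0 \<le> \<rho> x (\<gamma> t) + \<rho> (\<gamma> t) y" by (intro add_nonneg_nonneg enn2real_nonneg)
      ultimately show "\<rho> x (\<gamma> t) + \<rho> (\<gamma> t) y < c"
        using ennreal_less_iff by blast
    qed
  qed (use \<gamma> in \<open>auto simp: piecewise_smooth_path_iff pathstart_def pathfinish_def\<close>)
qed

text \<open>On a small compact Euclidean sphere around \<open>x\<close> the continuous function
  \<open>\<rho> x\<close> is positive, hence bounded below by some \<open>m > 0\<close>. A path from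
  \<open>x\<close> to a point outside the ball crosses the sphere, so it cannot have length below
  \<open>m\<close>.\<close>

lemma mball_subset_ball:
  assumes x: "x \<in> \<Omega>" and e: "e > 0"
  obtains m where "m > 0" "mball x m \<subseteq> ball x e"
proof -
  obtain e1 where e1: "e1 > 0" "cball x e1 \<subseteq> \<Omega>"
    using open_domain x open_contains_cball by blast
  define d where "d = min e1 (e / 2)"
  have d: "d > 0" "d < e" "cball x d \<subseteq> \<Omega>" using e e1 by (auto simp: d_def)
  have sph: "sphere x d \<subseteq> \<Omega>" using d(3) by auto
  have "\<exists>m>0. \<forall>y\<in>sphere x d. m \<le> \<rho> x y"
  proof (cases "sphere x d = {}")
    case False
    have "continuous_on (sphere x d) (\<lambda>y. \<rho> x y)"
      using continuous_on_\<rho>[OF x] sph by (rule continuous_on_subset)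
    then obtain p where p: "p \<in> sphere x d" "\<forall>y\<in>sphere x d. \<rho> x p \<le> \<rho> x y"
      using continuous_attains_inf[OF compact_sphere False] by blast
    have "p \<noteq> x" "p \<in> \<Omega>" using p(1) d sph by auto
    then have "\<rho> x p > 0" using mdist_pos_less[of x p] x by auto
    with p(2) show ?thesis by blast
  qed (auto intro: exI[of _ 1])
  then obtain m where m: "m > 0" "\<And>y. y \<in> sphere x d \<Longrightarrow> m \<le> \<rho> x y" by blast
  have "y \<in> ball x e" if y: "y \<in> mball x m" for y
  proof (rule ccontr)
    assume far: "y \<notin> ball x e"
    have y': "y \<in> \<Omega>" "\<rho> x y < m" using y by auto
    obtain \<gamma> where \<gamma>: "path \<gamma>" "path_image \<gamma> \<subseteq> \<Omega>" "pathstart \<gamma> = x" "pathfinish \<gamma> = y"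
      "\<forall>t\<in>{0..1}. \<rho> x (\<gamma> t) + \<rho> (\<gamma> t) y < m"
      using path_length_lt[OF x y'] by blast
    have "continuous_on {0..1} (\<lambda>t. dist x (\<gamma> t))"
      using \<gamma>(1) unfolding path_def by (intro continuous_intros)
    moreover have "dist x (\<gamma> 0) \<le> d" "d \<le> dist x (\<gamma> 1)"
      using \<gamma>(3,4) d far by (auto simp: pathstart_def pathfinish_def)
    ultimately obtain t where t: "0 \<le> t" "t \<le> 1" "dist x (\<gamma> t) = d"
      using IVT'[of "\<lambda>t. dist x (\<gamma> t)" 0 d 1] by auto
    have "m \<le> \<rho> x (\<gamma> t)" using t by (intro m) simp
    moreover have "\<rho> x (\<gamma> t) + \<rho> (\<gamma> t) y < m" using \<gamma>(5) t by simp
    ultimately show False using enn2real_nonneg[of "minimal_pseudodist \<Omega> (\<gamma> t) y"] by linarith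
  qed
  with m(1) show thesis using that by blast
qed

text \<open>One inclusion comes from the upper bound by affine discs in
  \<open>\<rho>_locally_le\<close>, the other from \<open>mball_subset_ball\<close>. As a
  consequence, compactness for \<open>\<rho>\<close> and Euclidean compactness agree on subsets of
  \<Omega>.\<close>

lemma mtopology_eq: "mtopology = top_of_set \<Omega>"
  unfolding topology_eq
proof (intro allI iffI)
  fix U assume U: "openin mtopology U"
  have "\<exists>e>0. ball p e \<subseteq> U" if p: "p \<in> U" for p
  proof -
    obtain r where r: "r > 0" "mball p r \<subseteq> U" using U p openin_mtopology by blast
    have p\<Omega>: "p \<in> \<Omega>" using U p openin_mtopology by blast
    obtain \<delta> where \<delta>: "\<delta> > 0" "ball p \<delta> \<subseteq> \<Omega>" "\<And>y. y \<in> ball p \<delta> \<Longrightarrow> \<rho> p y \<le> dist p y / \<delta>"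
      using \<rho>_locally_le[OF p\<Omega>] by blast
    have "y \<in> mball p r" if y: "y \<in> ball p (min \<delta> (\<delta> * r))" for y
    proof -
      have "dist p y / \<delta> < r" using y \<delta>(1) by (simp add: divide_less_eq mult.commute)
      then show ?thesis using \<delta>(2) \<delta>(3)[of y] y p\<Omega> by fastforce
    qed
    moreover have "min \<delta> (\<delta> * r) > 0" using \<delta>(1) r(1) by simp
    ultimately show ?thesis using r(2) by blast
  qed
  then have "open U" unfolding open_contains_ball by blast
  then show "openin (top_of_set \<Omega>) U"
    using U openin_mtopology open_domain by (auto simp: openin_open_eq)
next
  fix U assume "openin (top_of_set \<Omega>) U"
  then have U: "open U" "U \<subseteq> \<Omega>" using open_domain by (auto simp: openin_open_eq)
  have "\<exists>r>0. mball p r \<subseteq> U" if p: "p \<in> U" for p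
  proof -
    obtain e where "e > 0" "ball p e \<subseteq> U" using U(1) p open_contains_ball by blast
    then show ?thesis using mball_subset_ball[of p e] p U(2) by (metis subset_iff)
  qed
  then show "openin mtopology U" using U(2) by (simp add: openin_mtopology)
qed

lemma compactin_mtopology_iff: "compactin mtopology S \<longleftrightarrow> compact S \<and> S \<subseteq> \<Omega>"
  by (simp add: mtopology_eq compactin_subtopology)

lemma mball_locally_mtotally_bounded:
  assumes x: "x \<in> \<Omega>"
  obtains m where "m > 0" "mtotally_bounded (mball x m)"
proof -
  obtain e where e: "e > 0" "cball x e \<subseteq> \<Omega>"
    using open_domain x open_contains_cball by blast
  obtain m where m: "m > 0" "mball x m \<subseteq> ball x e"
    using mball_subset_ball[OF x e(1)] by blast
  have "mtotally_bounded (cball x e)"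
    using e by (intro compactin_imp_mtotally_bounded) (simp add: compactin_mtopology_iff)
  then have "mtotally_bounded (mball x m)"
    using m(2) ball_subset_cball by (blast intro: mtotally_bounded_subset)
  with m(1) show thesis by (rule that)
qed

text \<open>Along a path of length below \<open>a + b\<close> the distance from \<open>x\<close>
  varies continuously from 0 to \<open>\<rho> x y\<close>, so it takes the value \<open>a\<close>
  unless \<open>y\<close> itself will do. At that point less than \<open>b\<close> remains.\<close>

lemma intermediate_point:
  assumes x: "x \<in> \<Omega>" and y: "y \<in> \<Omega>" and ab: "\<rho> x y < a + b" "a \<ge> 0" "b > 0"
  obtains z where "z \<in> \<Omega>" "\<rho> x z \<le> a" "\<rho> z y < b"
proof (cases "\<rho> x y \<le> a")
  case True
  then show thesis using that[of y] y ab zero[OF y y] by simp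
next
  case False
  obtain \<gamma> where \<gamma>: "path \<gamma>" "path_image \<gamma> \<subseteq> \<Omega>" "pathstart \<gamma> = x" "pathfinish \<gamma> = y"
    "\<forall>t\<in>{0..1}. \<rho> x (\<gamma> t) + \<rho> (\<gamma> t) y < a + b"
    using path_length_lt[OF x y ab(1)] by blast
  have "continuous_on {0..1} (\<lambda>t. \<rho> x (\<gamma> t))"
    by (rule continuous_on_compose2[OF continuous_on_\<rho>[OF x] \<gamma>(1,2)[unfolded path_def path_image_def]])
  moreover have "\<rho> x (\<gamma> 0) \<le> a" "a \<le> \<rho> x (\<gamma> 1)"
    using \<gamma>(3,4) ab False mdist_zero[OF x] by (simp_all add: pathstart_def pathfinish_def)
  ultimately obtain t where t: "0 \<le> t" "t \<le> 1" "\<rho> x (\<gamma> t) = a"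
    using IVT'[of "\<lambda>t. \<rho> x (\<gamma> t)" 0 a 1] by auto
  have "\<gamma> t \<in> \<Omega>" using \<gamma>(2) t by (auto simp: path_image_def)
  then show thesis
    using that[of "\<gamma> t"] t \<gamma>(5)[THEN bspec, of t] by simp
qed

lemma compactin_mcball:
  assumes mcomplete "mtotally_bounded (mcball x r)"
  shows "compactin mtopology (mcball x r)"
  using mtotally_bounded_eq_compact_closure_of[OF assms(1), of "mcball x r"] assms(2)
    closure_of_closedin[OF closedin_mcball] by simp

text \<open>The Hopf-Rinow argument. Otherwise the radii of totally bounded balls around
  \<open>x\<close> have a finite supremum \<open>R\<close>. Approximation from smaller balls makes
  the closed ball of radius \<open>R\<close> totally bounded, completeness makes it compact, and a
  finite cover by small totally bounded balls then reaches beyond \<open>R\<close>.\<close>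

lemma mtotally_bounded_mball:
  assumes complete: mcomplete and x: "x \<in> \<Omega>"
  shows "mtotally_bounded (mball x r)"
proof (rule ccontr)
  assume r: "\<not> mtotally_bounded (mball x r)"
  define T where "T = {r. mtotally_bounded (mball x r)}"
  have down: "s \<in> T" if "t \<in> T" "s \<le> t" for s t
    using that mball_subset_concentric[of s t x] mtotally_bounded_subset unfolding T_def by blast
  have bdd: "bdd_above T"
  proof (rule bdd_aboveI[of _ r])
    show "t \<le> r" if "t \<in> T" for t
      using down[OF that, of r] r by (force simp: T_def)
  qed
  obtain m where m: "m > 0" "m \<in> T"
    using mball_locally_mtotally_bounded[OF x] unfolding T_def by blast
  define R where "R = Sup T"
  have R: "R > 0" using cSup_upper[OF m(2) bdd] m(1) by (simp add: R_def)
  have below: "mtotally_bounded (mball x s)" if "s < R" for s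
  proof -
    have "T \<noteq> {}" using m(2) by blast
    then obtain t where "t \<in> T" "s < t"
      using less_cSup_iff[OF _ bdd, of s] \<open>s < R\<close> unfolding R_def by blast
    then show ?thesis using down[of t s] by (simp add: T_def)
  qed
  have "mtotally_bounded (mcball x R)"
    unfolding mtotally_bounded_def
  proof (intro allI impI)
    fix \<epsilon> :: real assume \<epsilon>: "\<epsilon> > 0"
    \<comment> \<open>A point of the closed ball is within \<open>3 * \<eta>\<close>, at most
      \<open>\<epsilon> / 2\<close>, of a point of the ball of radius \<open>R - \<eta>\<close>,
      whose net has mesh \<open>\<epsilon> / 2\<close>. The bound \<open>R / 4\<close> keeps
      \<open>R - 2 * \<eta>\<close> nonnegative for \<open>intermediate_point\<close>.\<close>
    define \<eta> where "\<eta> = min (\<epsilon> / 6) (R / 4)"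
    have \<eta>: "\<eta> > 0" "3 * \<eta> \<le> \<epsilon> / 2" "2 * \<eta> \<le> R" using \<epsilon> R by (auto simp: \<eta>_def)
    obtain K where K: "finite K" "K \<subseteq> mball x (R - \<eta>)" "mball x (R - \<eta>) \<subseteq> (\<Union>k\<in>K. mball k (\<epsilon> / 2))"
      using below[of "R - \<eta>"] \<eta>(1) \<epsilon> unfolding mtotally_bounded_def
      by (metis diff_less_eq half_gt_zero less_add_same_cancel1)
    have "y \<in> (\<Union>k\<in>K. mball k \<epsilon>)" if y: "y \<in> mcball x R" for y
    proof -
      have y': "y \<in> \<Omega>" "\<rho> x y \<le> R" using y by auto
      obtain z where z: "z \<in> \<Omega>" "\<rho> x z \<le> R - 2 * \<eta>" "\<rho> z y < 3 * \<eta>"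
        using intermediate_point[OF x y'(1), of "R - 2 * \<eta>" "3 * \<eta>"] y'(2) \<eta> by auto
      then have "z \<in> mball x (R - \<eta>)" using x \<eta>(1) by simp
      then obtain k where k: "k \<in> K" "k \<in> \<Omega>" "\<rho> k z < \<epsilon> / 2" using K(3) by auto
      then have "\<rho> k y < \<epsilon>" using triangle[OF k(2) z(1) y'(1)] z(3) \<eta>(2) by linarith
      then show ?thesis using k y'(1) by auto
    qed
    moreover have "K \<subseteq> mcball x R" using K(2) \<eta>(1) by force
    ultimately show "\<exists>K. finite K \<and> K \<subseteq> mcball x R \<and> mcball x R \<subseteq> (\<Union>k\<in>K. mball k \<epsilon>)"
      using K(1) by blast
  qed
  then have C: "compactin mtopology (mcball x R)"
    by (rule compactin_mcball[OF complete])
  have "\<forall>p\<in>\<Omega>. \<exists>m>0. mtotally_bounded (mball p m)"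
    using mball_locally_mtotally_bounded by blast
  from bchoice[OF this] obtain m
    where m: "\<And>p. p \<in> \<Omega> \<Longrightarrow> m p > 0" "\<And>p. p \<in> \<Omega> \<Longrightarrow> mtotally_bounded (mball p (m p))"
    by blast
  \<comment> \<open>Covering with half the radii leaves room for a further step of length below
    \<open>\<delta>\<close>, so the balls with full radii \<open>m p\<close> cover the ball of
    radius \<open>R + \<delta>\<close>.\<close>
  have "mcball x R \<subseteq> \<Union> ((\<lambda>p. mball p (m p / 2)) ` mcball x R)"
    using m(1) by auto
  from compactinD[OF C _ this] obtain \<F> where \<F>: "finite \<F>"
    "\<F> \<subseteq> (\<lambda>p. mball p (m p / 2)) ` mcball x R" "mcball x R \<subseteq> \<Union> \<F>"
    by auto
  then obtain F where F: "finite F" "F \<subseteq> mcball x R" "mcball x R \<subseteq> (\<Union>p\<in>F. mball p (m p / 2))"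
    using finite_subset_image[OF \<F>(1,2)] by blast
  \<comment> \<open>Inserting 1 guarantees that \<open>Min\<close> is taken over a nonempty
    set.\<close>
  define \<delta> where "\<delta> = Min (insert 1 ((\<lambda>p. m p / 2) ` F))"
  have F\<Omega>: "F \<subseteq> \<Omega>" using F(2) by auto
  have \<delta>: "\<delta> > 0" "\<And>p. p \<in> F \<Longrightarrow> \<delta> \<le> m p / 2"
  proof -
    show "\<delta> > 0" using F(1) F\<Omega> m(1) by (auto simp: \<delta>_def)
    show "\<delta> \<le> m p / 2" if "p \<in> F" for p
      unfolding \<delta>_def by (rule Min_le) (use F(1) that in auto)
  qed
  have "mball x (R + \<delta>) \<subseteq> (\<Union>p\<in>F. mball p (m p))"
  proof
    fix y assume "y \<in> mball x (R + \<delta>)"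
    then have y: "y \<in> \<Omega>" "\<rho> x y < R + \<delta>" by auto
    obtain z where z: "z \<in> \<Omega>" "\<rho> x z \<le> R" "\<rho> z y < \<delta>"
      using intermediate_point[OF x y] R \<delta>(1) by auto
    then have "z \<in> mcball x R" using x by simp
    then obtain p where p: "p \<in> F" "p \<in> \<Omega>" "\<rho> p z < m p / 2" using F(3) by auto
    then have "\<rho> p y < m p" using triangle[OF p(2) z(1) y(1)] z(3) \<delta>(2)[OF p(1)] by linarith
    then show "y \<in> (\<Union>p\<in>F. mball p (m p))" using p y(1) by auto
  qed
  moreover have "mtotally_bounded (\<Union>p\<in>F. mball p (m p))"
    using F(1) F\<Omega> m(2) by (intro mtotally_bounded_Union) auto
  ultimately have "R + \<delta> \<in> T"
    unfolding T_def using mtotally_bounded_subset by blast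
  then have "R + \<delta> \<le> R" unfolding R_def using bdd by (rule cSup_upper)
  then show False using \<delta>(1) by simp
qed

lemma compact_mcball:
  assumes complete: mcomplete and x: "x \<in> \<Omega>"
  shows "compact (mcball x r)"
proof -
  have "mcball x r \<subseteq> mball x (r + 1)" by auto
  then have "mtotally_bounded (mcball x r)"
    using mtotally_bounded_mball[OF complete x] mtotally_bounded_subset by blast
  then show ?thesis
    using compactin_mcball[OF complete] compactin_mtopology_iff by blast
qed

lemma \<rho>_CH_le:
  assumes "f \<in> CH unit_disc \<Omega>" "norm z \<le> s" "norm w \<le> s" "s < 1"
  shows "\<rho> (f z) (f w) \<le> 2 / (1 - s)"
proof -
  have "\<rho> (f z) (f w) \<le> norm (w - z) / (1 - s)"
    using minimal_pseudodist_CH_le[OF dim open_domain assms] CH_D(3)[OF assms(1)] assms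
    by (subst \<rho>_le_iff) auto
  also have "\<dots> \<le> 2 / (1 - s)"
    using norm_triangle_ineq4[of w z] assms by (intro divide_right_mono) auto
  finally show ?thesis .
qed

section \<open>Normality of the family of conformal harmonic discs\<close>

lemma taut_if_mcomplete:
  assumes complete: mcomplete and ne: "\<Omega> \<noteq> {}"
  shows "taut \<Omega>"
  unfolding taut_def normal_family_def
proof (intro allI impI)
  fix f :: "nat \<Rightarrow> complex \<Rightarrow> real ^ 'n" assume "range f \<subseteq> CH unit_disc \<Omega>"
  then have f: "f n \<in> CH unit_disc \<Omega>" for n by blast
  show "\<exists>r. strict_mono (r :: nat \<Rightarrow> nat) \<and>
           ((\<exists>g. g ` unit_disc \<subseteq> \<Omega> \<and>
                 (\<forall>K. compact K \<and> K \<subseteq> unit_disc \<longrightarrow> uniform_limit K (f \<circ> r) g sequentially)) \<or>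
            compactly_divergent unit_disc \<Omega> (f \<circ> r))"
  proof (cases "compactly_divergent unit_disc \<Omega> f")
    case True
    then show ?thesis by (intro exI[of _ id]) (simp add: strict_mono_id)
  next
    case False
    then obtain K K' where K: "compact K" "K \<subseteq> unit_disc" and K': "compact K'" "K' \<subseteq> \<Omega>"
      and inf: "infinite {i. f i ` K \<inter> K' \<noteq> {}}"
      unfolding compactly_divergent_def by blast
    \<comment> \<open>Failure of compact divergence gives infinitely many maps that meet
      \<open>K'\<close> over \<open>K\<close>; the further extraction takes place within
      these.\<close>
    define q where "q = enumerate {i. f i ` K \<inter> K' \<noteq> {}}"
    have q: "strict_mono q" "\<And>i. f (q i) ` K \<inter> K' \<noteq> {}"
      using strict_mono_enumerate[OF inf] enumerate_in_set[OF inf] by (auto simp: q_def)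
    have "\<exists>z. z \<in> K \<and> f (q i) z \<in> K'" for i
      using q(2)[of i] by blast
    then obtain \<zeta> where \<zeta>: "\<And>i. \<zeta> i \<in> K" "\<And>i. f (q i) (\<zeta> i) \<in> K'"
      by metis
    obtain x where x: "x \<in> \<Omega>" using ne by blast
    have "compact ((\<lambda>y. \<rho> x y) ` K')"
      using continuous_on_subset[OF continuous_on_\<rho>[OF x] K'(2)] K'(1) by (rule compact_continuous_image)
    then obtain B where B: "\<And>y. y \<in> K' \<Longrightarrow> \<rho> x y \<le> B"
      using compact_imp_bounded bounded_real by (metis abs_le_D1 imageI)
    obtain sK where sK: "sK < 1" "\<And>z. z \<in> K \<Longrightarrow> norm z \<le> sK"
    proof -
      have "continuous_on K norm" by (intro continuous_intros)
      moreover have "K \<noteq> {}" using \<zeta>(1) by blast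
      ultimately obtain z0 where "z0 \<in> K" "\<And>z. z \<in> K \<Longrightarrow> norm z \<le> norm z0"
        using continuous_attains_sup[OF K(1), of norm] by blast
      then show thesis using that[of "norm z0"] K(2) by auto
    qed
    \<comment> \<open>Both \<open>z\<close> and the anchor point \<open>\<zeta> i\<close> lie in the
      disc of radius \<open>max s sK\<close>, so \<open>\<rho>_CH_le\<close> bounds the distance
      between their images independently of \<open>i\<close>.\<close>
    have inside: "f (q i) z \<in> mcball x (B + 2 / (1 - max s sK))" if "norm z \<le> s" "s < 1" for i z s
    proof -
      have z: "f (q i) z \<in> \<Omega>" using that by (intro CH_D(3)[OF f]) simp
      have "\<rho> (f (q i) (\<zeta> i)) (f (q i) z) \<le> 2 / (1 - max s sK)"
        using that sK \<zeta>(1)[of i] by (intro \<rho>_CH_le[OF f]) (auto simp: le_max_iff_disj)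
      moreover have "\<rho> x (f (q i) (\<zeta> i)) \<le> B" using B \<zeta>(2) by blast
      ultimately have "\<rho> x (f (q i) z) \<le> B + 2 / (1 - max s sK)"
        using triangle[OF x _ z, of "f (q i) (\<zeta> i)"] \<zeta>(2) K'(2) by fastforce
      then show ?thesis using x z by simp
    qed
    have bound: "\<exists>M. \<forall>n z. norm z \<le> s \<longrightarrow> norm (f (q n) z) \<le> M" if s: "s < 1" for s
    proof -
      have "bounded (mcball x (B + 2 / (1 - max s sK)))"
        using compact_mcball[OF complete x] compact_imp_bounded by blast
      then obtain M where "\<forall>y\<in>mcball x (B + 2 / (1 - max s sK)). norm y \<le> M"
        unfolding bounded_iff by blast
      then show ?thesis using inside s by blast
    qed
    obtain g r where gr: "strict_mono (r :: nat \<Rightarrow> nat)"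
      "\<And>K. compact K \<Longrightarrow> K \<subseteq> unit_disc \<Longrightarrow> uniform_limit K ((\<lambda>n. f (q n)) \<circ> r) g sequentially"
      using harmonic_Montel[of "\<lambda>n. f (q n)", OF CH_D(1)[OF f] bound] by blast
    \<comment> \<open>The values at \<open>z\<close> stay in one closed \<rho>-ball, which is
      compact and hence closed in the ambient space. The limit therefore cannot reach the boundary
      of \<Omega>.\<close>
    have "g z \<in> \<Omega>" if z: "z \<in> unit_disc" for z
    proof -
      let ?C = "mcball x (B + 2 / (1 - max (norm z) sK))"
      have lim: "(\<lambda>n. f (q (r n)) z) \<longlonglongrightarrow> g z"
        using tendsto_uniform_limitI[OF gr(2)[of "{z}"], of z] z by simp
      have "closed ?C"
        using compact_mcball[OF complete x] by (rule compact_imp_closed)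
      moreover have "f (q (r n)) z \<in> ?C" for n
        using z by (intro inside) auto
      ultimately have "g z \<in> ?C"
        using lim by (rule closed_sequentially)
      then show ?thesis by simp
    qed
    then have "g ` unit_disc \<subseteq> \<Omega>" by blast
    moreover have "uniform_limit K (f \<circ> (q \<circ> r)) g sequentially" if "compact K" "K \<subseteq> unit_disc" for K
      using gr(2)[OF that] by (simp add: o_def)
    moreover have "strict_mono (q \<circ> r)"
      using q(1) gr(1) by (rule strict_mono_o)
    ultimately show ?thesis
      by blast
  qed
qed

end

lemma complete_hyperbolic_imp_taut:
  fixes \<Omega> :: "(real ^ 'n) set"
  assumes dim: "CARD('n) \<ge> 2" and \<Omega>: "open \<Omega>" "\<Omega> \<noteq> {}" and complete: "complete_hyperbolic \<Omega>"
  shows "taut \<Omega>"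
proof -
  interpret minimal_metric_space \<Omega>
    using complete dim \<Omega>(1)
    by (simp add: minimal_metric_space_def minimal_metric_space_axioms_def complete_hyperbolic_def)
  show ?thesis
    using taut_if_mcomplete complete \<Omega>(2) by (simp add: complete_hyperbolic_def)
qed

theorem theorem4p8:
  fixes \<Omega> :: "(real ^ 'n) set"
  assumes "CARD('n) \<ge> 3" and "is_domain \<Omega>"
  shows "(complete_hyperbolic \<Omega> \<longrightarrow> taut \<Omega>) \<and> (taut \<Omega> \<longrightarrow> hyperbolic \<Omega>)"
proof -
  have "CARD('n) \<ge> 2" "open \<Omega>" "\<Omega> \<noteq> {}"
    using assms by (auto simp: is_domain_def)
  then show ?thesis
    using complete_hyperbolic_imp_taut taut_imp_hyperbolic by blast
qed

end
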